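(* There exists a family $(P_d, \mathbf{c}_d)_{d \geq 3}$, where $P_d$ is a $(d+1)$-dimensional polytope in $\mathbb{R}^{d+1}$ with $(2d+1)(d+1)+1$ facets and $\mathbf{c}_d \in \mathbb{R}^{d+1}$ is a linear objective function, such that any monotone path of polynomial length on $P_d$ is superpolynomially many flips away from any coherent monotone path. That is: for all polynomials $p$ and $q$ there exists $d_0$ such that for every $d \geq d_0$, every monotone path on $P_d$ (with respect to $\mathbf{c}_d$) of length at most $p(d)$ is at distance greater than $q(d)$, in the flip graph of monotone paths of $(P_d,\mathbf{c}_d)$, from every coherent monotone path on $P_d$ with respect to $\mathbf{c}_d$.
   Context: Let $P \subset \mathbb{R}^{n}$ be a polytope and $\mathbf{c} \in \mathbb{R}^{n}$. A monotone path (with respect to $\mathbf{c}$) is a path in the graph of $P$ from some minimizer of $\mathbf{c}^{\top}\mathbf{x}$ over $P$ to some maximizer, along which $\mathbf{c}^{\top}\mathbf{x}$ strictly increases at each step; its length is its number of edges. Given $\mathbf{w}$ linearly independent of $\mathbf{c}$, consider the set of all faces of $P$ that are the set of maximizers of $(\mathbf{w}+\lambda \mathbf{c})^{\top}\mathbf{x}$ over $P$ for some $\lambda \in \mathbb{R}$; if these are all vertices or edges they form a monotone path, and monotone paths arising in this way are called coherent. The flip graph of monotone paths of $(P,\mathbf{c})$ has the monotone paths as nodes; two distinct monotone paths are adjacent (differ by a flip) if they agree outside of a single two-dimensional face $F$ of $P$, i.e. they coincide except for the portion in the boundary of $F$, where each follows one of the two monotone paths along the boundary of $F$. The distance between two nodes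 is the graph distance (infinite if they lie in different components). *)

theory Defs
  imports "HOL-Analysis.Analysis" "HOL-Analysis.Finite_Function_Topology"
begin

text \<open>The dimension \<open>n\<close> varies inside a single statement, so \<open>\<real>\<^sup>n\<close> is
  the subspace of vectors supported on \<open>{..<n}\<close> in the space \<open>nat \<Rightarrow>\<^sub>0 real\<close> of finitely
  supported sequences. This type is an instance of \<^class>\<open>real_vector\<close>, so the library notions
  \<^const>\<open>polytope\<close>, \<^const>\<open>face_of\<close>, \<^const>\<open>extreme_point_of\<close> and
  \<^const>\<open>real_vector.independent\<close> apply to it.\<close>

definition coord_space :: "nat \<Rightarrow> (nat \<Rightarrow>\<^sub>0 real) set" where
  "coord_space n = {x. Poly_Mapping.keys x \<subseteq> {..<n}}"

definition dot :: "(nat \<Rightarrow>\<^sub>0 real) \<Rightarrow> (nat \<Rightarrow>\<^sub>0 real) \<Rightarrow> real" where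
  "dot c x = (\<Sum>i\<in>Poly_Mapping.keys c. Poly_Mapping.lookup c i * Poly_Mapping.lookup x i)"

text \<open>The library's \<^const>\<open>aff_dim\<close>, \<^const>\<open>edge_of\<close> and \<^const>\<open>facet_of\<close> are restricted
  to \<^class>\<open>euclidean_space\<close>; these are the same definitions over \<^class>\<open>real_vector\<close>,
  except that finiteness of \<open>B\<close>, automatic in finite dimension, has to be required.\<close>

definition affine_dim :: "'a::real_vector set \<Rightarrow> int" where
  "affine_dim V = (SOME d :: int.
     \<exists>B. finite B \<and> affine hull B = affine hull V \<and> \<not> affine_dependent B \<and> of_nat (card B) = d + 1)"

lemma affine_dim_eq_aff_dim: "affine_dim V = aff_dim V"
  unfolding affine_dim_def aff_dim_def
  by (metis aff_independent_finite)

definition is_facet :: "'a::real_vector set \<Rightarrow> 'a set \<Rightarrow> bool" where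
  "is_facet F S \<longleftrightarrow> F face_of S \<and> F \<noteq> {} \<and> affine_dim F = affine_dim S - 1"

definition is_edge :: "'a::real_vector set \<Rightarrow> 'a set \<Rightarrow> bool" where
  "is_edge e S \<longleftrightarrow> e face_of S \<and> affine_dim e = 1"

definition minimizers :: "(nat \<Rightarrow>\<^sub>0 real) set \<Rightarrow> (nat \<Rightarrow>\<^sub>0 real) \<Rightarrow> (nat \<Rightarrow>\<^sub>0 real) set" where
  "minimizers P c = {x \<in> P. \<forall>y\<in>P. dot c x \<le> dot c y}"

definition maximizers :: "(nat \<Rightarrow>\<^sub>0 real) set \<Rightarrow> (nat \<Rightarrow>\<^sub>0 real) \<Rightarrow> (nat \<Rightarrow>\<^sub>0 real) set" where
  "maximizers P c = {x \<in> P. \<forall>y\<in>P. dot c y \<le> dot c x}"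

text \<open>A path is represented by the list of its vertices.\<close>

definition monotone_path ::
    "(nat \<Rightarrow>\<^sub>0 real) set \<Rightarrow> (nat \<Rightarrow>\<^sub>0 real) \<Rightarrow> (nat \<Rightarrow>\<^sub>0 real) list \<Rightarrow> bool" where
  "monotone_path P c vs \<longleftrightarrow>
     vs \<noteq> [] \<and> (\<forall>v\<in>set vs. v extreme_point_of P) \<and>
     hd vs \<in> minimizers P c \<and> last vs \<in> maximizers P c \<and>
     successively (\<lambda>u v. is_edge (closed_segment u v) P \<and> dot c u < dot c v) vs"

definition path_length :: "'a list \<Rightarrow> nat" where
  "path_length vs = length vs - 1"

definition path_faces :: "'a::real_vector list \<Rightarrow> 'a set set" where
  "path_faces vs = {{v} | v. v \<in> set vs} \<union>
     {closed_segment (vs ! i) (vs ! Suc i) | i. Suc i < length vs}"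

text \<open>The condition \<open>c \<noteq> w\<close> is needed because \<open>{c, w}\<close> collapses to a singleton
  when \<open>c = w\<close>.\<close>

definition coherent_path ::
    "nat \<Rightarrow> (nat \<Rightarrow>\<^sub>0 real) set \<Rightarrow> (nat \<Rightarrow>\<^sub>0 real) \<Rightarrow> (nat \<Rightarrow>\<^sub>0 real) list \<Rightarrow> bool" where
  "coherent_path n P c vs \<longleftrightarrow>
     monotone_path P c vs \<and>
     (\<exists>w\<in>coord_space n. c \<noteq> w \<and> independent {c, w} \<and>
        {maximizers P (w + t *\<^sub>R c) | t. t \<in> UNIV} = path_faces vs)"

text \<open>The two paths agree outside the \<open>2\<close>-face \<open>F\<close> and inside it run along monotone paths
  \<open>as\<close> and \<open>bs\<close> of \<open>F\<close>. If the paths have a nonempty common part before \<open>F\<close>, the edge entering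
  \<open>F\<close> does not lie in \<open>F\<close>, hence must be common to both paths, too; similarly for the edge
  leaving \<open>F\<close>. This matters only when \<open>c\<close> has several minimizers or maximizers on \<open>F\<close>.\<close>

definition flip_adjacent ::
    "(nat \<Rightarrow>\<^sub>0 real) set \<Rightarrow> (nat \<Rightarrow>\<^sub>0 real) \<Rightarrow>
     (nat \<Rightarrow>\<^sub>0 real) list \<Rightarrow> (nat \<Rightarrow>\<^sub>0 real) list \<Rightarrow> bool" where
  "flip_adjacent P c us vs \<longleftrightarrow>
     monotone_path P c us \<and> monotone_path P c vs \<and> us \<noteq> vs \<and>
     (\<exists>F pre as bs post. F face_of P \<and> affine_dim F = 2 \<and>
        monotone_path F c as \<and> monotone_path F c bs \<and>
        us = pre @ as @ post \<and> vs = pre @ bs @ post \<and>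
        (pre \<noteq> [] \<longrightarrow> hd as = hd bs) \<and> (post \<noteq> [] \<longrightarrow> last as = last bs))"

text \<open>The infimum of the empty set is \<open>\<infinity>\<close>.\<close>

definition flip_distance ::
    "(nat \<Rightarrow>\<^sub>0 real) set \<Rightarrow> (nat \<Rightarrow>\<^sub>0 real) \<Rightarrow>
     (nat \<Rightarrow>\<^sub>0 real) list \<Rightarrow> (nat \<Rightarrow>\<^sub>0 real) list \<Rightarrow> enat" where
  "flip_distance P c us vs = (INF k\<in>{k. (flip_adjacent P c ^^ k) us vs}. enat k)"

end

theory Submission
  imports Defs "HOL-Real_Asymp.Real_Asymp"
begin

text \<open>Every edge of a \<open>2\<close>-face lies on its own facet inequality, so a flip changes the length of a
  path by at most the number of facets. It is therefore enough that all coherent paths are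
  exponentially long.

  Let \<open>c\<close> be the all-ones vector. Modulo \<open>c\<close>, every \<open>w\<close> has nonnegative entries and \<open>w i = 0\<close> for
  some \<open>i\<close>, so that the \<open>d + 1\<close> orthants \<open>w i = 0\<close> cover all directions. For each \<open>i\<close> there is a patch
  of \<open>2 * d + 1\<close> inequalities: \<open>2 * d\<close> of them are a deformed cube
  \<open>u r \<le> min (2 * u (r + 1)) (2 - 2 * u (r + 1))\<close> for \<open>r < d\<close>, where \<open>u d\<close> is an affine function
  of \<open>c \<bullet> x\<close>, and every maximizer path for \<open>w\<close> in the \<open>i\<close>-th orthant runs through the
  \<open>2 ^ (d - 1)\<close> vertices at the bends of the iterated tent map; the last one bounds the slices.
  Around the height \<open>32 ^ (2 * i)\<close> of \<open>c \<bullet> x / (d + 1)\<close> all other patches are slack, so the patches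
  do not interfere. One more inequality bounds \<open>c \<bullet> x\<close> from above.\<close>

section \<open>Affine dimension\<close>

text \<open>Coherence quantifies over all \<open>w\<close>, while the duality argument on one
  deformed cube works only for \<open>w\<close> in one cone; hence the stack along \<open>c\<close>,
  in which a coherent path is long because of the one patch that fits its \<open>w\<close>. The
  cones are closed, so many entries of \<open>w\<close> may tie with the smallest one. Each patch is
  therefore written in tilted coordinates, in which every weight of the objective lies between
  \<open>S / d\<close> and \<open>2 * S\<close>, with \<open>S\<close> the sum of the normalised
  entries of \<open>w\<close>. Rescaling successive coordinates by \<open>8 * (real d + 1)\<close>
  then makes the weights grow by a factor above \<open>4\<close>, uniformly over the cone. Since
  \<open>u d\<close> depends on \<open>c \<bullet> x\<close> alone, adding a multiple of
  \<open>c\<close> to \<open>w\<close> gives it any desired coefficient. For each choice of branches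
  of the tent map one such multiple turns the duality bound into an optimality proof, so the
  corresponding vertex is a unique maximizer and lies on the path. The base \<open>32\<close> is
  \<open>4 * 8\<close>: the points considered near the height of patch \<open>i\<close> have
  deviations at most \<open>8 * 32 ^ i\<close>, and a patch is slack where its radius is at least
  four times the deviations.\<close>

lemma affine_independent_insert:
  assumes "\<not> affine_dependent B" "x \<notin> affine hull B"
  shows "\<not> affine_dependent (insert x B)"
proof (cases "B = {}")
  case False
  then obtain a where a: "a \<in> B" by blast
  define S where "S = (\<lambda>y. -a + y) ` (B - {a})"
  have xB: "x \<notin> B" using assms(2) hull_inc by metis
  have S: "independent S"
    using assms(1) affine_dependent_iff_dependent2[OF a] unfolding S_def by blast
  have x: "- a + x \<notin> span S"
  proof
    assume "- a + x \<in> span S"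
    then have "a + (- a + x) \<in> affine hull B"
      unfolding affine_hull_span2[OF a] S_def by blast
    with assms(2) show False by simp
  qed
  have "(\<lambda>y. -a + y) ` (insert x B - {a}) = insert (-a + x) S"
    using xB a unfolding S_def by auto
  then show ?thesis
    using independent_insertI[OF x S] affine_dependent_iff_dependent2[of a "insert x B"] a by simp
qed (simp add: affine_independent_1)

text \<open>Steinitz exchange, after translating \<open>B\<close> and \<open>C\<close> by one of
  their own points. Finiteness of \<open>B\<close> is part of the conclusion because the ambient
  space may be infinite-dimensional.\<close>

lemma affine_independent_card_le:
  assumes "finite C" "\<not> affine_dependent B" "B \<subseteq> affine hull C"
  shows "finite B \<and> card B \<le> card C"
proof (cases "B = {}")
  case False
  then obtain b where b: "b \<in> B" by blast
  have "C \<noteq> {}" using b assms(3) by auto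
  then obtain c where c: "c \<in> C" by blast
  define S where "S = (\<lambda>y. -b + y) ` (B - {b})"
  define T where "T = (\<lambda>y. -c + y) ` (C - {c})"
  have T: "- c + y \<in> span T" if "y \<in> B" for y
    using that assms(3) affine_hull_span2[OF c] unfolding T_def by auto
  have "S \<subseteq> span T"
  proof
    fix s assume "s \<in> S"
    then obtain y where y: "y \<in> B" "s = -b + y" unfolding S_def by blast
    have "s = (- c + y) - (- c + b)" using y by simp
    then show "s \<in> span T" using T y(1) b span_diff by metis
  qed
  moreover have "independent S"
    using assms(2) affine_dependent_iff_dependent2[OF b] unfolding S_def by blast
  moreover have "finite T" unfolding T_def using assms(1) by simp
  ultimately have *: "finite S \<and> card S \<le> card T"
    using real_vector.independent_span_bound by blast
  have inj: "inj_on (\<lambda>y. -b + y) (B - {b})" "inj_on (\<lambda>y. -c + y) (C - {c})" by (auto simp: inj_on_def)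
  have "finite (B - {b})" using * finite_image_iff[OF inj(1)] unfolding S_def by simp
  then have "finite B" by simp
  moreover have "card (B - {b}) \<le> card (C - {c})"
    using * card_image[OF inj(1)] card_image[OF inj(2)] unfolding S_def T_def by simp
  moreover have "card B > 0" "card C > 0" using b c \<open>finite B\<close> assms(1) card_gt_0_iff by blast+
  ultimately show ?thesis using b c assms(1) by (simp add: card_Diff_singleton)
qed simp

text \<open>\<open>affine_dim\<close> is a Hilbert choice, so its value is determined only once all
  finite affine bases of the same hull are known to have equal size; the exchange bound is applied
  in both directions.\<close>

lemma affine_dim_eq_card:
  assumes "finite B" "\<not> affine_dependent B" "affine hull B = affine hull S"
  shows "affine_dim S = int (card B) - 1"
  unfolding affine_dim_def
proof (rule some_equality)
  show "\<exists>C. finite C \<and> affine hull C = affine hull S \<and> \<not> affine_dependent C \<and>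
      of_nat (card C) = int (card B) - 1 + 1"
    using assms by (intro exI[of _ B]) simp
next
  fix k :: int assume "\<exists>C. finite C \<and> affine hull C = affine hull S \<and> \<not> affine_dependent C \<and>
      of_nat (card C) = k + 1"
  then obtain C where C: "finite C" "affine hull C = affine hull S" "\<not> affine_dependent C"
      "int (card C) = k + 1" by auto
  have "card C \<le> card B"
    by (rule conjunct2[OF affine_independent_card_le[OF assms(1) C(3)]])
      (metis C(2) assms(3) hull_subset)
  moreover have "card B \<le> card C"
    by (rule conjunct2[OF affine_independent_card_le[OF C(1) assms(2)]])
      (metis C(2) assms(3) hull_subset)
  ultimately show "k = int (card B) - 1" using C(4) by simp
qed

text \<open>The set \<open>C\<close> certifies finite dimension, without which
  \<open>affine_dim S\<close> would be an unspecified number.\<close>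

lemma affine_dim_basis:
  assumes "finite C" "S \<subseteq> affine hull C"
  obtains B where "finite B" "B \<subseteq> S" "\<not> affine_dependent B" "affine hull B = affine hull S"
    "affine_dim S = int (card B) - 1"
proof -
  obtain B where B: "B \<subseteq> S" "\<not> affine_dependent B" "affine hull S = affine hull B"
    using affine_basis_exists by blast
  then have "finite B" using affine_independent_card_le[OF assms(1) B(2)] assms(2) by blast
  with B that affine_dim_eq_card[of B S] show thesis by metis
qed

section \<open>Polyhedra given by affine inequalities\<close>

definition affine_fun :: "('v::real_vector \<Rightarrow> real) \<Rightarrow> bool" where
  "affine_fun h \<longleftrightarrow> (\<forall>x y z k. h (x + k *\<^sub>R (y - z)) = h x + k * (h y - h z))"

lemma affine_funD: "affine_fun h \<Longrightarrow> h (x + k *\<^sub>R (y - z)) = h x + k * (h y - h z)"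
  by (simp add: affine_fun_def)

lemma affine_fun_line: "affine_fun h \<Longrightarrow> h (x + k *\<^sub>R u) = h x + k * (h (x + u) - h x)"
  using affine_funD[of h x k "x + u" x] by simp

lemma affine_fun_convex_comb:
  "affine_fun h \<Longrightarrow> u + v = 1 \<Longrightarrow> h (u *\<^sub>R x + v *\<^sub>R y) = u * h x + v * h y"
proof -
  assume h: "affine_fun h" and uv: "u + v = 1"
  then have u: "u = 1 - v" by simp
  have "u *\<^sub>R x + v *\<^sub>R y = x + v *\<^sub>R (y - x)" by (simp add: u algebra_simps)
  then show ?thesis using affine_funD[OF h, of x v y x] by (simp add: u algebra_simps)
qed

lemma affine_zero_set: "affine_fun h \<Longrightarrow> affine {x. h x = 0}"
  by (simp add: affine_def affine_fun_convex_comb)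

lemma small_step:
  fixes c m :: "'i \<Rightarrow> real"
  assumes "finite A" "\<And>a. a \<in> A \<Longrightarrow> c a < 0"
  shows "\<exists>e>0. \<forall>a\<in>A. \<forall>t. 0 \<le> t \<longrightarrow> t \<le> e \<longrightarrow> c a + t * m a < 0"
  using assms
proof (induction A)
  case (insert b A)
  then obtain e where e: "e > 0" "\<forall>a\<in>A. \<forall>t. 0 \<le> t \<longrightarrow> t \<le> e \<longrightarrow> c a + t * m a < 0" by auto
  \<comment> \<open>The \<open>1 +\<close> keeps the quotient meaningful when \<open>m b = 0\<close>
    and the inequality strict at \<open>t = f\<close>.\<close>
  define f where "f = - c b / (1 + \<bar>m b\<bar>)"
  have "c b < 0" using insert.prems by simp
  then have f: "f > 0" unfolding f_def by (intro divide_pos_pos) auto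
  have "c b + t * m b < 0" if "0 \<le> t" "t \<le> f" for t
  proof (cases "t = 0")
    case False
    have "t * m b \<le> t * \<bar>m b\<bar>" using that by (intro mult_left_mono) auto
    also have "\<dots> < t * (1 + \<bar>m b\<bar>)" using that False by (intro mult_strict_left_mono) auto
    also have "\<dots> \<le> f * (1 + \<bar>m b\<bar>)" using that by (intro mult_right_mono) auto
    also have "\<dots> = - c b" unfolding f_def by (simp add: add_nonneg_eq_0_iff)
    finally show ?thesis by simp
  qed (use insert.prems in auto)
  then show ?case using e f by (intro exI[of _ "min e f"]) auto
qed (auto intro: exI[of _ 1])

locale affine_system =
  fixes V :: "'v::real_vector set" and A :: "'i set" and h :: "'i \<Rightarrow> 'v \<Rightarrow> real"
  assumes subspace_V: "subspace V"
    and finite_A: "finite A"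
    and affine_h: "\<And>a. a \<in> A \<Longrightarrow> affine_fun (h a)"
begin

section \<open>Feasible sets of finite systems and their faces\<close>

definition feasible :: "'v set" where
  "feasible = {x \<in> V. \<forall>a\<in>A. h a x \<le> 0}"

definition tight :: "'v set \<Rightarrow> 'i set" where
  "tight F = {a \<in> A. \<forall>y\<in>F. h a y = 0}"

lemma V_step: "x \<in> V \<Longrightarrow> y \<in> V \<Longrightarrow> z \<in> V \<Longrightarrow> x + k *\<^sub>R (y - z) \<in> V"
  using subspace_V by (simp add: subspace_add subspace_diff subspace_scale)

lemma convex_feasible: "convex feasible"
proof (rule convexI)
  fix x y u v
  assume *: "x \<in> feasible" "y \<in> feasible" "0 \<le> u" "0 \<le> v" "u + v = (1::real)"
  then have "u * h a x + v * h a y \<le> 0" if "a \<in> A" for a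
    using that unfolding feasible_def by (simp add: add_nonpos_nonpos mult_nonneg_nonpos)
  then show "u *\<^sub>R x + v *\<^sub>R y \<in> feasible"
    using * subspace_V unfolding feasible_def
    by (simp add: affine_fun_convex_comb[OF affine_h] subspace_add subspace_scale)
qed

text \<open>A relative interior point is built one inequality at a time: the midpoint with a point
  where \<open>b\<close> is strict keeps strict whatever was strict before.\<close>

lemma face_relative_interior_point:
  assumes "convex F" "F \<subseteq> feasible" "F \<noteq> {}"
  obtains z where "z \<in> F" "\<And>a. a \<in> A - tight F \<Longrightarrow> h a z < 0"
proof -
  have "\<exists>z\<in>F. \<forall>a\<in>J. h a z < 0" if "finite J" "J \<subseteq> A - tight F" for J
    using that
  proof (induction J)
    case empty
    then show ?case using assms(3) by auto
  next
    case (insert b J)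
    then obtain z where z: "z \<in> F" "\<forall>a\<in>J. h a z < 0" by auto
    from insert.prems obtain y where y: "y \<in> F" "h b y \<noteq> 0" unfolding tight_def by auto
    define m where "m = (1/2) *\<^sub>R z + (1/2) *\<^sub>R y"
    have m: "m \<in> F" unfolding m_def using assms(1) z(1) y(1) by (intro convexD) auto
    have le: "h a z \<le> 0" "h a y \<le> 0" if "a \<in> A" for a
      using that z(1) y(1) assms(2) unfolding feasible_def by auto
    have hm: "h a m = (h a z + h a y) / 2" if "a \<in> A" for a
      unfolding m_def using that by (simp add: affine_fun_convex_comb[OF affine_h])
    have "h a m < 0" if "a \<in> insert b J" for a
    proof -
      have "a \<in> A" using that insert.prems by auto
      moreover have "h a z < 0 \<or> h a y < 0"
        using that z(2) y(2) le(2)[OF \<open>a \<in> A\<close>] by auto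
      ultimately show ?thesis using hm[of a] le[of a] by auto
    qed
    then show ?case using m by blast
  qed
  then show thesis using that finite_A by (metis finite_Diff order_refl)
qed

text \<open>If \<open>x\<close> satisfies the tight inequalities of \<open>F\<close> with equality,
  the segment from \<open>x\<close> to a relative interior point \<open>z\<close> of
  \<open>F\<close> can be prolonged a little beyond \<open>z\<close>. Then \<open>z\<close> lies
  strictly between two feasible points, and the face property puts \<open>x\<close> into
  \<open>F\<close>.\<close>

lemma face_eq_tight:
  assumes F: "F face_of feasible" "F \<noteq> {}"
  shows "F = {x \<in> feasible. \<forall>a\<in>tight F. h a x = 0}"
proof
  show "F \<subseteq> {x \<in> feasible. \<forall>a\<in>tight F. h a x = 0}"
    using face_of_imp_subset[OF F(1)] unfolding tight_def by auto
  show "{x \<in> feasible. \<forall>a\<in>tight F. h a x = 0} \<subseteq> F"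
  proof
    fix x assume x: "x \<in> {x \<in> feasible. \<forall>a\<in>tight F. h a x = 0}"
    obtain z where z: "z \<in> F" "\<And>a. a \<in> A - tight F \<Longrightarrow> h a z < 0"
      using face_relative_interior_point face_of_imp_convex[OF F(1)]
        face_of_imp_subset[OF F(1)] F(2) by metis
    show "x \<in> F"
    proof (cases "x = z")
      case False
      obtain e where e: "e > 0" "\<forall>a\<in>A - tight F. h a z + e * (h a z - h a x) < 0"
        using small_step[of "A - tight F" "\<lambda>a. h a z" "\<lambda>a. h a z - h a x"] z(2) finite_A
        by (meson finite_Diff order_refl less_imp_le)
      define w where "w = z + e *\<^sub>R (z - x)"
      have zV: "z \<in> V" "x \<in> V" "z \<in> feasible"
        using z(1) face_of_imp_subset[OF F(1)] x unfolding feasible_def by auto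
      have "h a w \<le> 0" if "a \<in> A" for a
      proof (cases "a \<in> tight F")
        case True
        then have "h a z = 0" "h a x = 0" using z(1) x unfolding tight_def by auto
        then show ?thesis unfolding w_def using affine_funD[OF affine_h[OF that]] by simp
      next
        case False
        then show ?thesis unfolding w_def using affine_funD[OF affine_h[OF that]] e(2) that
          by (metis DiffI less_imp_le)
      qed
      then have w: "w \<in> feasible"
        unfolding feasible_def w_def using V_step zV by auto
      have "z = (1 - 1/(1+e)) *\<^sub>R x + (1/(1+e)) *\<^sub>R w"
      proof -
        have "(1+e) *\<^sub>R ((1 - 1/(1+e)) *\<^sub>R x + (1/(1+e)) *\<^sub>R w) = e *\<^sub>R x + w"
          using e(1) by (simp add: scaleR_add_right field_simps)
        also have "\<dots> = (1+e) *\<^sub>R z" unfolding w_def by (simp add: algebra_simps)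
        finally show ?thesis using e(1) by simp
      qed
      moreover have "x \<noteq> w"
      proof
        assume "x = w"
        then have "(1+e) *\<^sub>R (z - x) = 0" unfolding w_def by (simp add: algebra_simps)
        then show False using e(1) False by simp
      qed
      ultimately have "z \<in> open_segment x w" using e(1) unfolding in_segment
        by (intro conjI exI[of _ "1/(1+e)"]) auto
      then show ?thesis using F(1) x w z(1) unfolding face_of_def by blast
    qed (use z in auto)
  qed
qed

text \<open>The ratio test of the simplex method: the first inequality of positive slope along
  \<open>u\<close> to become tight limits the step, and those tight at \<open>x\<close> stay tight
  because their slope is zero.\<close>

lemma hit_constraint:
  assumes x: "x \<in> feasible" and u: "u \<in> V" "u \<noteq> 0"
    and ray: "\<exists>t>0. x + t *\<^sub>R u \<notin> feasible"
    and keep: "\<And>a. a \<in> tight {x} \<Longrightarrow> h a (x + u) = 0"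
  obtains t where "t > 0" "x + t *\<^sub>R u \<in> feasible" "tight {x} \<subset> tight {x + t *\<^sub>R u}"
proof -
  define m where "m a = h a (x + u) - h a x" for a
  have line: "h a (x + t *\<^sub>R u) = h a x + t * m a" if "a \<in> A" for a t
    unfolding m_def using affine_fun_line[OF affine_h[OF that]] by simp
  have xA: "h a x \<le> 0" if "a \<in> A" for a using x that unfolding feasible_def by auto
  have inV: "x + t *\<^sub>R u \<in> V" for t
    using x u subspace_V unfolding feasible_def by (simp add: subspace_add subspace_scale)
  define D where "D = {a \<in> A. m a > 0}"
  have finD: "finite D" unfolding D_def using finite_A by simp
  have "D \<noteq> {}"
  proof
    assume "D = {}"
    then have "m a \<le> 0" if "a \<in> A" for a using that unfolding D_def by force
    then have "x + t *\<^sub>R u \<in> feasible" if "t > 0" for t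
      using that inV line xA unfolding feasible_def
      by (simp add: add_nonpos_nonpos mult_nonneg_nonpos)
    with ray show False by blast
  qed
  define r where "r a = - h a x / m a" for a
  define t where "t = Min (r ` D)"
  obtain b where b: "b \<in> D" "t = r b"
    using Min_in[of "r ` D"] finD \<open>D \<noteq> {}\<close> unfolding t_def by fast
  have tle: "t \<le> r a" if "a \<in> D" for a unfolding t_def using finD that by simp
  have m0: "m a = 0" if "a \<in> tight {x}" for a
    using keep[OF that] that unfolding tight_def m_def by simp
  have bx: "h b x < 0"
    using m0[of b] b(1) xA[of b] unfolding D_def tight_def by force
  have t: "t > 0" unfolding b(2) r_def using bx b(1) unfolding D_def by (auto intro: divide_neg_pos)
  have le: "h a (x + t *\<^sub>R u) \<le> 0" if "a \<in> A" for a
  proof (cases "a \<in> D")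
    case True
    then have "t * m a \<le> - h a x"
      using tle[OF True] pos_le_divide_eq[of "m a" t "- h a x"] unfolding r_def D_def by blast
    then show ?thesis using line that by simp
  next
    case False
    then show ?thesis using line that xA[OF that] t unfolding D_def
      by (simp add: add_nonpos_nonpos mult_nonneg_nonpos)
  qed
  have "b \<in> tight {x + t *\<^sub>R u}"
  proof -
    have "b \<in> A" "t * m b = - h b x" using b unfolding D_def r_def by auto
    then show ?thesis using line[of b t] unfolding tight_def by simp
  qed
  moreover have "b \<notin> tight {x}" using bx unfolding tight_def by simp
  moreover have "tight {x} \<subseteq> tight {x + t *\<^sub>R u}"
    using m0 line unfolding tight_def by auto
  ultimately show thesis using that t le inV unfolding feasible_def by blast
qed

text \<open>A point not determined by its tight inequalities can move in two opposite directions
  until more of them become tight. It thus lies between two points with fewer slack inequalities,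
  and induction on their number ends in vertices.\<close>

lemma polytope_feasible:
  assumes "\<And>x u. x \<in> feasible \<Longrightarrow> u \<in> V \<Longrightarrow> u \<noteq> 0 \<Longrightarrow> \<exists>t>0. x + t *\<^sub>R u \<notin> feasible"
  shows "polytope feasible"
proof -
  \<comment> \<open>The vertices: feasible points determined by their tight inequalities, hence at
    most as many as there are subsets of \<open>A\<close>.\<close>
  define W where "W = {x \<in> feasible. \<forall>y\<in>V. (\<forall>a\<in>tight {x}. h a y = 0) \<longrightarrow> y = x}"
  have "inj_on (\<lambda>x. tight {x}) W"
  proof (rule inj_onI)
    fix x y assume xy: "x \<in> W" "y \<in> W" "tight {x} = tight {y}"
    then have "\<forall>a\<in>tight {x}. h a y = 0" unfolding tight_def by auto
    then show "x = y" using xy unfolding W_def feasible_def by blast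
  qed
  moreover have "(\<lambda>x. tight {x}) ` W \<subseteq> Pow A" unfolding tight_def by auto
  ultimately have finW: "finite W"
    using finite_A by (meson finite_Pow_iff finite_imageD finite_subset)
  have "x \<in> convex hull W" if "x \<in> feasible" for x
    using that
  proof (induction "card (A - tight {x})" arbitrary: x rule: less_induct)
    case less
    show ?case
    proof (cases "x \<in> W")
      case True
      then show ?thesis by (rule hull_inc)
    next
      case False
      then obtain y where y: "y \<in> V" "\<forall>a\<in>tight {x}. h a y = 0" "y \<noteq> x"
        using less.prems unfolding W_def by blast
      define u where "u = y - x"
      have xV: "x \<in> V" using less.prems unfolding feasible_def by simp
      have u: "u \<in> V" "u \<noteq> 0" "-u \<in> V" "-u \<noteq> 0"
        using y xV subspace_V unfolding u_def
        by (auto simp: subspace_diff)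
      have k1: "h a (x + u) = 0" if "a \<in> tight {x}" for a using y that unfolding u_def by simp
      have k2: "h a (x + - u) = 0" if "a \<in> tight {x}" for a
        using affine_fun_line[OF affine_h, of a x "-1" u] k1[OF that] that
        unfolding tight_def by simp
      have smaller: "card (A - tight {z}) < card (A - tight {x})" if "tight {x} \<subset> tight {z}" for z
        using that finite_A by (intro psubset_card_mono) (auto simp: tight_def)
      obtain s where s: "s > 0" "x + s *\<^sub>R u \<in> feasible" "tight {x} \<subset> tight {x + s *\<^sub>R u}"
        using hit_constraint[OF less.prems u(1,2) assms[OF less.prems u(1,2)] k1] by blast
      obtain t where t: "t > 0" "x + t *\<^sub>R (-u) \<in> feasible" "tight {x} \<subset> tight {x + t *\<^sub>R (-u)}"
        using hit_constraint[OF less.prems u(3,4) assms[OF less.prems u(3,4)] k2] by blast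
      have "x + s *\<^sub>R u \<in> convex hull W" "x + t *\<^sub>R (-u) \<in> convex hull W"
        using less.hyps smaller s t by blast+
      then have "(t/(s+t)) *\<^sub>R (x + s *\<^sub>R u) + (s/(s+t)) *\<^sub>R (x + t *\<^sub>R (-u)) \<in> convex hull W"
        using s(1) t(1) by (intro convexD) (auto simp: add_divide_distrib[symmetric])
      moreover have "(t/(s+t)) *\<^sub>R (x + s *\<^sub>R u) + (s/(s+t)) *\<^sub>R (x + t *\<^sub>R (-u)) = x"
      proof -
        have "(t/(s+t)) *\<^sub>R (x + s *\<^sub>R u) + (s/(s+t)) *\<^sub>R (x + t *\<^sub>R (-u))
            = (t/(s+t) + s/(s+t)) *\<^sub>R x"
          by (simp add: algebra_simps)
        also have "t/(s+t) + s/(s+t) = 1" using s(1) t(1) by (simp add: add_divide_distrib[symmetric])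
        finally show ?thesis by simp
      qed
      ultimately show ?thesis by simp
    qed
  qed
  moreover have "convex hull W \<subseteq> feasible"
    using convex_feasible by (intro hull_minimal) (auto simp: W_def)
  ultimately have "feasible = convex hull W" by blast
  with finW show ?thesis unfolding polytope_def by blast
qed

section \<open>Facets of irredundant systems and paths in two-dimensional faces\<close>

definition wall :: "'i \<Rightarrow> 'v set" where
  "wall a = {x \<in> feasible. h a x = 0}"

lemma wall_face: "a \<in> A \<Longrightarrow> wall a face_of feasible"
  unfolding face_of_def
proof (intro conjI ballI impI)
  assume a: "a \<in> A"
  show "wall a \<subseteq> feasible" unfolding wall_def by blast
  show "convex (wall a)"
    using convex_Int[OF convex_feasible affine_imp_convex[OF affine_zero_set[OF affine_h[OF a]]]]
    unfolding wall_def by (simp add: Int_def)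
next
  fix x y z
  assume *: "a \<in> A" "x \<in> feasible" "y \<in> feasible" "z \<in> wall a" "z \<in> open_segment x y"
  then obtain u where u: "0 < u" "u < 1" "z = (1 - u) *\<^sub>R x + u *\<^sub>R y"
    unfolding in_segment by blast
  have "h a z = (1 - u) * h a x + u * h a y"
    unfolding u(3) using affine_fun_convex_comb[OF affine_h[OF *(1)]] by simp
  moreover have "h a z = 0" "h a x \<le> 0" "h a y \<le> 0"
    using * unfolding wall_def feasible_def by auto
  moreover have "(1 - u) * h a x \<le> 0" "u * h a y \<le> 0"
    using u calculation by (auto simp: mult_nonneg_nonpos)
  ultimately have "(1 - u) * h a x = 0" "u * h a y = 0" by linarith+
  then show "x \<in> wall a" "y \<in> wall a" using u * unfolding wall_def by auto
qed

text \<open>Stretching by \<open>1/e\<close> away from \<open>p\<close> recovers every point of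
  \<open>S\<close> from a point of \<open>F\<close>.\<close>

lemma affine_hull_dense:
  assumes S: "affine S" "S \<subseteq> V"
    and p: "p \<in> S" "p \<in> F"
    and F: "F \<subseteq> S" "\<And>x. x \<in> S \<Longrightarrow> \<exists>e>0. p + e *\<^sub>R (x - p) \<in> F"
  shows "affine hull F = S"
proof
  show "affine hull F \<subseteq> S" using S(1) F(1) by (simp add: hull_minimal)
  show "S \<subseteq> affine hull F"
  proof
    fix x assume "x \<in> S"
    then obtain e where e: "e > 0" "p + e *\<^sub>R (x - p) \<in> F" using F by blast
    have "(1 - 1/e) *\<^sub>R p + (1/e) *\<^sub>R (p + e *\<^sub>R (x - p)) \<in> affine hull F"
      using e p(2) by (intro mem_affine[OF affine_affine_hull] hull_inc) auto
    moreover have "(1 - 1/e) *\<^sub>R p + (1/e) *\<^sub>R (p + e *\<^sub>R (x - p)) = x"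
      using e(1) by (simp add: algebra_simps)
    ultimately show "x \<in> affine hull F" by simp
  qed
qed

lemma affine_hull_feasible:
  assumes p: "p \<in> V" "\<And>a. a \<in> A \<Longrightarrow> h a p < 0"
  shows "affine hull feasible = V"
proof (rule affine_hull_dense[of _ p])
  show "affine V" using subspace_V by (rule subspace_imp_affine)
  show "p \<in> feasible" using p unfolding feasible_def by (auto intro: less_imp_le)
  show "feasible \<subseteq> V" unfolding feasible_def by blast
  fix x assume x: "x \<in> V"
  obtain e where e: "e > 0" "\<forall>a\<in>A. \<forall>t. 0 \<le> t \<longrightarrow> t \<le> e \<longrightarrow> h a p + t * (h a x - h a p) < 0"
    using small_step[of A "\<lambda>a. h a p" "\<lambda>a. h a x - h a p"] finite_A p(2) by blast
  have "p + e *\<^sub>R (x - p) \<in> feasible"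
    unfolding feasible_def using V_step[OF p(1) x p(1)] e affine_funD[OF affine_h]
    by (auto intro!: less_imp_le)
  with e show "\<exists>e>0. p + e *\<^sub>R (x - p) \<in> feasible" by blast
qed (use p in auto)

lemma affine_hull_wall:
  assumes a: "a \<in> A" and z: "z \<in> V" "h a z = 0" "\<And>b. b \<in> A \<Longrightarrow> b \<noteq> a \<Longrightarrow> h b z < 0"
  shows "affine hull (wall a) = {x \<in> V. h a x = 0}"
proof (rule affine_hull_dense[of _ z])
  show "affine {x \<in> V. h a x = 0}"
    using affine_Int[OF subspace_imp_affine[OF subspace_V] affine_zero_set[OF affine_h[OF a]]]
    by (simp add: Int_def)
  show "z \<in> wall a" using z unfolding wall_def feasible_def by force
  show "wall a \<subseteq> {x \<in> V. h a x = 0}" unfolding wall_def feasible_def by blast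
  fix x assume x: "x \<in> {x \<in> V. h a x = 0}"
  obtain e where e: "e > 0"
      "\<forall>b\<in>A - {a}. \<forall>t. 0 \<le> t \<longrightarrow> t \<le> e \<longrightarrow> h b z + t * (h b x - h b z) < 0"
    using small_step[of "A - {a}" "\<lambda>b. h b z" "\<lambda>b. h b x - h b z"] finite_A z(3) by blast
  have line: "h b (z + e *\<^sub>R (x - z)) = h b z + e * (h b x - h b z)" if "b \<in> A" for b
    using affine_funD[OF affine_h[OF that]] .
  have 0: "h a (z + e *\<^sub>R (x - z)) = 0" using line[OF a] x z by simp
  have "h b (z + e *\<^sub>R (x - z)) \<le> 0" if "b \<in> A" for b
    using 0 line[OF that] e that by (cases "b = a") (auto intro: less_imp_le)
  then have "z + e *\<^sub>R (x - z) \<in> wall a"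
    unfolding wall_def feasible_def using V_step[of z x z e] x z 0 by simp
  with e show "\<exists>e>0. z + e *\<^sub>R (x - z) \<in> wall a" by blast
qed (use z in auto)

lemma affine_hull_insert_hyperplane:
  assumes a: "a \<in> A" and p: "p \<in> V" "h a p \<noteq> 0" and z: "z \<in> V" "h a z = 0"
  shows "affine hull (insert p {x \<in> V. h a x = 0}) = V"
proof
  show "affine hull (insert p {x \<in> V. h a x = 0}) \<subseteq> V"
    using p subspace_imp_affine[OF subspace_V] by (intro hull_minimal) auto
  show "V \<subseteq> affine hull (insert p {x \<in> V. h a x = 0})" (is "_ \<subseteq> ?H")
  proof
    fix v assume v: "v \<in> V"
    define k where "k = h a v / h a p"
    define y where "y = v + (-k) *\<^sub>R (p - z)"
    have "h a y = 0"
      unfolding y_def affine_funD[OF affine_h[OF a]] using p z by (simp add: k_def)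
    moreover have "y \<in> V" unfolding y_def using V_step v p z by blast
    ultimately have "y \<in> ?H" "z \<in> ?H" "p \<in> ?H" using z by (auto intro: hull_inc)
    then have "y + k *\<^sub>R (p - z) \<in> ?H"
      using mem_affine_3_minus[OF affine_affine_hull] by blast
    then show "v \<in> ?H" unfolding y_def by simp
  qed
qed

text \<open>The point \<open>p\<close> gives full dimension, and each inequality has a point where
  it alone is tight. Adding \<open>p\<close> to a basis of a wall gives a basis of \<open>V\<close>,
  so walls are facets. Conversely, the dimension of a facet forces one of those points into its
  affine hull, and this identifies the facet with a wall.\<close>

lemma card_facets:
  assumes C: "finite C" "\<not> affine_dependent C" "affine hull C = V"
    and p: "p \<in> V" "\<And>a. a \<in> A \<Longrightarrow> h a p < 0"
    and wit: "\<And>a. a \<in> A \<Longrightarrow> \<exists>z\<in>V. h a z = 0 \<and> (\<forall>b\<in>A. b \<noteq> a \<longrightarrow> h b z < 0)"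
  shows "affine_dim feasible = int (card C) - 1" "card {F. is_facet F feasible} = card A"
proof -
  show dimP: "affine_dim feasible = int (card C) - 1"
    using affine_dim_eq_card[OF C(1,2)] affine_hull_feasible[OF p] C(3) by simp
  obtain z where z: "\<And>a. a \<in> A \<Longrightarrow> z a \<in> V" "\<And>a. a \<in> A \<Longrightarrow> h a (z a) = 0"
      "\<And>a b. a \<in> A \<Longrightarrow> b \<in> A \<Longrightarrow> b \<noteq> a \<Longrightarrow> h b (z a) < 0"
    using wit by metis
  have zwall: "z a \<in> wall a" if "a \<in> A" for a
    unfolding wall_def feasible_def using z that by force
  have hull: "affine hull (wall a) = {x \<in> V. h a x = 0}" if "a \<in> A" for a
    using affine_hull_wall z that by blast
  have sub: "S \<subseteq> feasible \<Longrightarrow> S \<subseteq> affine hull C" for S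
    using C(3) unfolding feasible_def by blast
  have dimW: "affine_dim (wall a) = int (card C) - 2" if a: "a \<in> A" for a
  proof -
    have "wall a \<subseteq> affine hull C" by (rule sub) (auto simp: wall_def)
    then obtain B where B: "finite B" "\<not> affine_dependent B"
        "affine hull B = affine hull (wall a)" "affine_dim (wall a) = int (card B) - 1"
      using affine_dim_basis[OF C(1)] by metis
    have p': "p \<notin> affine hull B" using B(3) hull[OF a] p(2)[OF a] by simp
    then have pB: "p \<notin> B" using hull_inc by metis
    have "affine hull (insert p B) = affine hull (insert p (affine hull B))"
      by (metis hull_insert)
    also have "\<dots> = V"
      unfolding B(3) hull[OF a]
      by (rule affine_hull_insert_hyperplane[OF a p(1) _ z(1)[OF a] z(2)[OF a]]) (use p(2)[OF a] in simp)
    finally have "affine_dim V = int (card (insert p B)) - 1"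
      using affine_dim_eq_card[of "insert p B" V] affine_independent_insert[OF B(2) p'] B(1)
      by (simp add: hull_same subspace_imp_affine subspace_V)
    moreover have "affine_dim V = int (card C) - 1"
      using affine_dim_eq_card[of C V] C by (simp add: hull_same subspace_imp_affine subspace_V)
    ultimately show ?thesis using B(1,4) pB by simp
  qed
  have facet: "is_facet (wall a) feasible" if "a \<in> A" for a
    unfolding is_facet_def using wall_face[OF that] zwall[OF that] dimW[OF that] dimP by auto
  have conv: "F \<in> wall ` A" if "is_facet F feasible" for F
  proof -
    have F: "F face_of feasible" "F \<noteq> {}" "affine_dim F = int (card C) - 2"
      using that dimP unfolding is_facet_def by auto
    note eq = face_eq_tight[OF F(1,2)]
    have "tight F \<noteq> {}"
    proof
      assume "tight F = {}"
      then have "F = feasible" using eq by simp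
      then show False using F(3) dimP by simp
    qed
    then obtain a where a: "a \<in> tight F" by blast
    then have aA: "a \<in> A" unfolding tight_def by simp
    have "F \<subseteq> affine hull C" by (rule sub) (use face_of_imp_subset[OF F(1)] in simp)
    then obtain B where B: "finite B" "\<not> affine_dependent B" "B \<subseteq> F"
        "affine hull B = affine hull F" "affine_dim F = int (card B) - 1"
      using affine_dim_basis[OF C(1)] by metis
    have tightF: "affine hull F \<subseteq> {x. h b x = 0}" if "b \<in> tight F" for b
      using that affine_zero_set[OF affine_h] unfolding tight_def by (intro hull_minimal) auto
    \<comment> \<open>Otherwise a basis of \<open>F\<close> could be enlarged by \<open>z a\<close>,
      inside the hyperplane of \<open>a\<close>, and then by \<open>p\<close>, outside of it, which
      makes one point more than \<open>C\<close> has.\<close>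
    have za: "z a \<in> affine hull F"
    proof (rule ccontr)
      assume "z a \<notin> affine hull F"
      then have 1: "z a \<notin> affine hull B" using B by simp
      let ?B = "insert (z a) B"
      have "affine hull ?B \<subseteq> {x. h a x = 0}"
        using z(2)[OF aA] tightF[OF a] hull_subset[of F affine] B(3)
          affine_zero_set[OF affine_h[OF aA]]
        by (intro hull_minimal) auto
      then have 2: "p \<notin> affine hull ?B" using p(2)[OF aA] by auto
      have "\<not> affine_dependent (insert p ?B)"
        using affine_independent_insert[OF affine_independent_insert[OF B(2) 1] 2] .
      moreover have "insert p ?B \<subseteq> affine hull C"
        using p z(1)[OF aA] B(3) F(1) sub face_of_imp_subset C(3) by blast
      ultimately have "card (insert p ?B) \<le> card C"
        using affine_independent_card_le[OF C(1)] by blast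
      moreover have "z a \<notin> B" "p \<notin> ?B" using 1 2 hull_inc by metis+
      ultimately show False using B(1,5) F(3) by simp
    qed
    have "tight F = {a}"
    proof -
      have "b = a" if b: "b \<in> tight F" for b
        using tightF[OF b] za z(3)[OF aA, of b] b unfolding tight_def by force
      then show ?thesis using a by blast
    qed
    then have "F = wall a" using eq unfolding wall_def by simp
    then show ?thesis using aA by blast
  qed
  have "{F. is_facet F feasible} = wall ` A" using facet conv by blast
  moreover have "inj_on wall A"
  proof (rule inj_onI)
    fix a b assume *: "a \<in> A" "b \<in> A" "wall a = wall b"
    then have "h b (z a) = 0" using zwall[OF *(1)] unfolding wall_def by simp
    then show "a = b" using z(3)[OF *(1,2)] by force
  qed
  ultimately show "card {F. is_facet F feasible} = card A" by (simp add: card_image)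
qed

text \<open>Every edge of the path lies on an inequality that is not tight on all of \<open>F\<close>, and this
  inequality cuts \<open>F\<close> in a subset of a line, so it cannot contain another edge of the path.\<close>

lemma two_face_path_length:
  assumes C: "finite C" "V \<subseteq> affine hull C"
    and F: "F face_of feasible" "affine_dim F = 2"
    and f: "affine_fun f"
    and path: "successively (\<lambda>u v. is_edge (closed_segment u v) F \<and> f u < f v) xs"
  shows "length xs \<le> card A + 1"
proof -
  let ?e = "\<lambda>j. closed_segment (xs ! j) (xs ! Suc j)"
  have edge: "is_edge (?e j) F" "f (xs ! j) < f (xs ! Suc j)" if "Suc j < length xs" for j
    using path that unfolding successively_conv_nth by auto
  have "sorted_wrt (\<lambda>u v. f u < f v) xs"
  proof (subst successively_conv_sorted_wrt[symmetric])
    show "transp (\<lambda>u v. f u < f v)" by (auto intro: transpI)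
    show "successively (\<lambda>u v. f u < f v) xs"
      using path by (rule successively_mono) auto
  qed
  then have mono: "f (xs ! j) \<le> f (xs ! k)" if "j \<le> k" "k < length xs" for j k
    using that by (cases "j = k") (auto simp: sorted_wrt_iff_nth_less intro: less_imp_le)
  have FV: "F \<subseteq> feasible" using F(1) by (rule face_of_imp_subset)
  have "F \<subseteq> affine hull C" using FV C(2) unfolding feasible_def by blast
  then obtain B where B: "finite B" "affine hull B = affine hull F" "affine_dim F = int (card B) - 1"
    using affine_dim_basis[OF C(1)] by metis
  have card3: "card B = 3" using B(3) F(2) by simp
  \<comment> \<open>An edge with the same tight inequalities as \<open>F\<close> would equal
    \<open>F\<close>, against the dimensions \<open>1\<close> and \<open>2\<close>.\<close>
  have "\<exists>a\<in>tight (?e j). a \<notin> tight F" if "Suc j < length xs" for j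
  proof (rule ccontr)
    assume "\<not> ?thesis"
    moreover have eF: "?e j face_of F" using edge(1)[OF that] unfolding is_edge_def by simp
    ultimately have "tight (?e j) = tight F"
      using face_of_imp_subset[OF eF] unfolding tight_def by auto
    moreover have "?e j face_of feasible" using face_of_trans[OF eF F(1)] .
    moreover have "?e j \<noteq> {}" "F \<noteq> {}" using face_of_imp_subset[OF eF] by auto
    ultimately have "?e j = F" using face_eq_tight[of "?e j"] face_eq_tight[OF F(1)] by metis
    then have "affine_dim F = 1" using edge(1)[OF that] unfolding is_edge_def by simp
    then show False using F(2) by simp
  qed
  then obtain a where a: "\<And>j. Suc j < length xs \<Longrightarrow> a j \<in> tight (?e j) \<and> a j \<notin> tight F"
    by metis
  have neq: "a j \<noteq> a k" if jk: "j < k" "Suc k < length xs" for j k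
  proof
    assume eq: "a j = a k"
    define u v w where "u = xs ! j" and "v = xs ! Suc j" and "w = xs ! Suc k"
    have j: "Suc j < length xs" using jk by simp
    have aA: "a j \<in> A" using a[OF j] unfolding tight_def by simp
    have h0: "h (a j) u = 0" "h (a j) v = 0" "h (a j) w = 0"
      using a[OF j] a[OF jk(2)] eq unfolding tight_def u_def v_def w_def by auto
    have uv: "f u < f v" unfolding u_def v_def using edge(2)[OF j] .
    have vw: "f v < f w" unfolding v_def w_def
      using edge(2)[OF jk(2)] mono[of "Suc j" k] jk by simp
    have eF: "?e j face_of F" "?e k face_of F"
      using edge(1)[OF j] edge(1)[OF jk(2)] unfolding is_edge_def by auto
    have inF: "u \<in> F" "v \<in> F" "w \<in> F"
      using face_of_imp_subset[OF eF(1)] face_of_imp_subset[OF eF(2)]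
      unfolding u_def v_def w_def by auto
    obtain x where x: "x \<in> F" "h (a j) x \<noteq> 0" using a[OF j] aA unfolding tight_def by blast
    \<comment> \<open>The hyperplane of \<open>a j\<close> misses \<open>x\<close>, so it meets the
      plane of \<open>F\<close> in at most a line, and this line is spanned by \<open>u\<close> and
      \<open>v\<close>.\<close>
    have w: "w \<in> affine hull {u, v}"
    proof (rule ccontr)
      assume w: "w \<notin> affine hull {u, v}"
      have "affine hull {w, u, v} \<subseteq> {x. h (a j) x = 0}"
        using h0 affine_zero_set[OF affine_h[OF aA]] by (intro hull_minimal) auto
      then have x': "x \<notin> affine hull {w, u, v}" using x(2) by auto
      have "\<not> affine_dependent {x, w, u, v}"
        using affine_independent_insert[OF affine_independent_insert[OF affine_independent_2 w] x'] .
      moreover have "{x, w, u, v} \<subseteq> affine hull B"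
        using x(1) inF B(2) hull_inc by fastforce
      ultimately have "card {x, w, u, v} \<le> 3"
        using affine_independent_card_le[OF B(1)] card3 by metis
      moreover have "card {x, w, u, v} = 4"
      proof -
        have "x \<noteq> w" "x \<noteq> u" "x \<noteq> v" using x h0 by auto
        moreover have "w \<noteq> u" "w \<noteq> v" "u \<noteq> v" using uv vw by auto
        ultimately show ?thesis by simp
      qed
      ultimately show False by simp
    qed
    then obtain s t where st: "w = s *\<^sub>R u + t *\<^sub>R v" "s + t = 1"
      unfolding affine_hull_2 by blast
    have "f w = s * f u + t * f v" using affine_fun_convex_comb[OF f st(2)] st(1) by simp
    also have "s = 1 - t" using st(2) by simp
    finally have "f w - f v = (t - 1) * (f v - f u)" by (simp add: algebra_simps)
    then have "(t - 1) * (f v - f u) > 0" using vw by simp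
    \<comment> \<open>Hence \<open>v\<close> lies strictly between \<open>u\<close> and
      \<open>w\<close>. As the first edge is a face, it must contain \<open>w\<close>, although
      \<open>f\<close> does not exceed \<open>f v\<close> on it.\<close>
    then have t: "t > 1" using uv by (simp add: zero_less_mult_iff)
    have "v = (1 - 1/t) *\<^sub>R u + (1/t) *\<^sub>R w"
    proof -
      have "(1/t) *\<^sub>R w = (1/t - 1) *\<^sub>R u + v"
        using st t \<open>s = 1 - t\<close> by (simp add: scaleR_add_right diff_divide_distrib)
      then show ?thesis by (simp add: algebra_simps)
    qed
    moreover have "u \<noteq> w" using uv vw by auto
    ultimately have "v \<in> open_segment u w"
      unfolding in_segment using t by (intro conjI exI[of _ "1/t"]) auto
    moreover have "v \<in> ?e j" unfolding v_def by simp
    ultimately have "w \<in> closed_segment u v"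
      using eF(1) inF unfolding face_of_def u_def v_def by blast
    then obtain r where r: "0 \<le> r" "r \<le> 1" "w = (1 - r) *\<^sub>R u + r *\<^sub>R v"
      unfolding in_segment by blast
    then have "f w = (1 - r) * f u + r * f v" using affine_fun_convex_comb[OF f] by simp
    also have "\<dots> \<le> (1 - r) * f v + r * f v"
      using r uv by (intro add_right_mono mult_left_mono) auto
    also have "\<dots> = f v" by (simp add: algebra_simps)
    finally show False using vw by simp
  qed
  have "inj_on a {..<length xs - 1}"
  proof (rule inj_onI)
    fix j k assume "j \<in> {..<length xs - 1}" "k \<in> {..<length xs - 1}" "a j = a k"
    then show "j = k" using neq[of j k] neq[of k j]
      by (metis Suc_eq_plus1 lessThan_iff less_diff_conv linorder_neqE_nat)
  qed
  moreover have "a ` {..<length xs - 1} \<subseteq> A"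
    using a unfolding tight_def by auto
  ultimately have "card {..<length xs - 1} \<le> card A"
    using card_inj_on_le finite_A by blast
  then show ?thesis by simp
qed

end

section \<open>Chains of tent inequalities\<close>

text \<open>A backward orbit of \<open>1\<close> under the tent map
  \<open>min (2 * x) (2 - 2 * x)\<close>; the set \<open>E\<close> lists the levels at which the
  smaller preimage is taken.\<close>

primrec tent_orbit :: "nat set \<Rightarrow> nat \<Rightarrow> real" where
  "tent_orbit E 0 = 1"
| "tent_orbit E (Suc r) = (if r \<in> E then tent_orbit E r / 2 else 1 - tent_orbit E r / 2)"

definition tent_chain :: "nat \<Rightarrow> (nat \<Rightarrow> real) \<Rightarrow> bool" where
  "tent_chain n u \<longleftrightarrow> (\<forall>r<n. u r \<le> 2 * u (Suc r) \<and> u r \<le> 2 - 2 * u (Suc r))"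

lemma tent_orbit_bounds: "0 < tent_orbit E r" "tent_orbit E r \<le> 1"
  by (induction r) auto

lemma tent_orbit_Suc_less_1: "tent_orbit E (Suc r) < 1"
  using tent_orbit_bounds[of E r] by simp

lemma tent_chain_orbit: "tent_chain n (tent_orbit E)"
  unfolding tent_chain_def using tent_orbit_bounds[of E] by (simp add: field_simps)

text \<open>For \<open>r \<ge> 1\<close> the branch is visible in whether the next value lies below
  \<open>1/2\<close>. At \<open>r = 0\<close> the two preimages of \<open>1\<close> coincide, so the
  sets have to avoid \<open>0\<close>.\<close>

lemma tent_orbit_inj:
  assumes "E \<subseteq> {1..<n}" "E' \<subseteq> {1..<n}" "\<And>r. r \<le> n \<Longrightarrow> tent_orbit E r = tent_orbit E' r"
  shows "E = E'"
proof -
  have iff: "r \<in> D \<longleftrightarrow> tent_orbit D (Suc r) < 1/2" if "1 \<le> r" for r D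
    using tent_orbit_Suc_less_1[of D "r - 1"] tent_orbit_bounds(1)[of D r] that by simp
  have "r \<in> E \<longleftrightarrow> r \<in> E'" if "r \<in> {1..<n}" for r
    using that iff[of r E] iff[of r E'] assms(3)[of "Suc r"] by simp
  then show ?thesis using assms(1,2) by blast
qed

text \<open>Linear programming duality: at level \<open>0\<close> both inequalities are used with equal weight, at
  every level \<open>r > 0\<close> only one of them, selected by \<open>r \<in> E\<close>. The growth of the weights \<open>l\<close>
  keeps all the multipliers positive.\<close>

lemma tent_chain_bound:
  assumes "0 < l 0" "\<And>r. r < m \<Longrightarrow> 4 * l r < l (Suc r)"
  shows "\<exists>K \<tau>. \<bar>\<tau>\<bar> \<le> 4 * l m \<and> (\<forall>u. tent_chain (Suc m) u \<longrightarrow>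
     (\<Sum>r\<le>m. l r * u r) \<le> K + \<tau> * u (Suc m) \<and>
     ((\<Sum>r\<le>m. l r * u r) = K + \<tau> * u (Suc m) \<longleftrightarrow> (\<forall>r\<le>Suc m. u r = tent_orbit E r)))"
  using assms(2)
proof (induction m)
  case 0
  \<comment> \<open>Adding the two inequalities at level \<open>0\<close> gives
    \<open>u 0 \<le> 1\<close>, with equality only at the peak of the tent; hence
    \<open>K = l 0\<close> and \<open>\<tau> = 0\<close>.\<close>
  have "u 0 \<le> 1 \<and> (u 0 = 1 \<longleftrightarrow> u 0 = 1 \<and> u (Suc 0) = 1/2)" if "tent_chain (Suc 0) u" for u
    using that unfolding tent_chain_def by auto
  then have *: "u 0 \<le> 1 \<and> (u 0 = 1 \<longleftrightarrow> (\<forall>r\<le>Suc 0. u r = tent_orbit E r))" if "tent_chain (Suc 0) u" for u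
    using that by (auto simp: le_Suc_eq)
  show ?case
    by (intro exI[of _ "l 0"] exI[of _ 0]) (use * assms(1) in simp)
next
  case (Suc m)
  from Suc.IH[OF Suc.prems[OF less_SucI]] obtain K \<tau> where ih: "\<bar>\<tau>\<bar> \<le> 4 * l m \<and> (\<forall>u. tent_chain (Suc m) u \<longrightarrow>
     (\<Sum>r\<le>m. l r * u r) \<le> K + \<tau> * u (Suc m) \<and>
     ((\<Sum>r\<le>m. l r * u r) = K + \<tau> * u (Suc m) \<longleftrightarrow> (\<forall>r\<le>Suc m. u r = tent_orbit E r)))"
    by auto
  note \<tau> = conjunct1[OF ih]
    and bound = mp[OF spec[OF conjunct2[OF ih]], THEN conjunct1]
    and eq = mp[OF spec[OF conjunct2[OF ih]], THEN conjunct2]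
  have lm: "4 * l m < l (Suc m)" using Suc.prems by simp
  \<comment> \<open>The total weight now resting on \<open>u (Suc m)\<close>. As
    \<open>\<bar>\<tau>\<bar> < l (Suc m)\<close>, it is positive and below
    \<open>2 * l (Suc m)\<close>; the slope \<open>2\<close> or \<open>-2\<close> of the chosen
    branch then restores the invariant \<open>4 * l\<close>.\<close>
  define L where "L = l (Suc m) + \<tau>"
  have L: "0 < L" "L \<le> 2 * l (Suc m)" unfolding L_def using \<tau> lm by auto
  define s where "s = (if Suc m \<in> E then 2 else - 2 :: real)"
  define K' where "K' = K + (if Suc m \<in> E then 0 else 2 * L)"
  have key: "(\<Sum>r\<le>Suc m. l r * u r) \<le> K' + s * L * u (Suc (Suc m)) \<and>
     ((\<Sum>r\<le>Suc m. l r * u r) = K' + s * L * u (Suc (Suc m)) \<longleftrightarrow>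
       (\<forall>r\<le>Suc (Suc m). u r = tent_orbit E r))"
    if u: "tent_chain (Suc (Suc m)) u" for u
  proof -
    have u': "tent_chain (Suc m) u" using u unfolding tent_chain_def by simp
    define br where "br = (if Suc m \<in> E then 2 * u (Suc (Suc m)) else 2 - 2 * u (Suc (Suc m)))"
    have br: "u (Suc m) \<le> br" using u unfolding tent_chain_def br_def by auto
    have sum: "(\<Sum>r\<le>Suc m. l r * u r) = (\<Sum>r\<le>m. l r * u r) + l (Suc m) * u (Suc m)" by simp
    have rhs: "K' + s * L * u (Suc (Suc m)) = K + L * br"
      unfolding K'_def s_def br_def by (auto simp: algebra_simps)
    have 1: "K + \<tau> * u (Suc m) + l (Suc m) * u (Suc m) = K + L * u (Suc m)"
      unfolding L_def by (simp add: algebra_simps)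
    have 2: "L * u (Suc m) \<le> L * br" using br L by (intro mult_left_mono) auto
    have 3: "L * u (Suc m) = L * br \<longleftrightarrow> u (Suc m) = br" using L by simp
    have orb: "u (Suc m) = br \<longleftrightarrow> u (Suc (Suc m)) = tent_orbit E (Suc (Suc m))"
      if "u (Suc m) = tent_orbit E (Suc m)"
      using that unfolding br_def by (auto simp del: tent_orbit.simps simp: tent_orbit.simps(2)[of _ "Suc m"] field_simps)
    have all: "(\<forall>r\<le>Suc (Suc m). u r = tent_orbit E r) \<longleftrightarrow>
        (\<forall>r\<le>Suc m. u r = tent_orbit E r) \<and> u (Suc (Suc m)) = tent_orbit E (Suc (Suc m))"
      by (metis le_Suc_eq)
    have "(\<Sum>r\<le>Suc m. l r * u r) = K' + s * L * u (Suc (Suc m)) \<longleftrightarrow>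
        (\<Sum>r\<le>m. l r * u r) = K + \<tau> * u (Suc m) \<and> u (Suc m) = br"
      unfolding sum rhs using bound[OF u'] 1 2 3 by linarith
    moreover have "\<dots> \<longleftrightarrow> (\<forall>r\<le>Suc (Suc m). u r = tent_orbit E r)"
      unfolding all eq[OF u'] using orb by blast
    moreover have "(\<Sum>r\<le>Suc m. l r * u r) \<le> K' + s * L * u (Suc (Suc m))"
      unfolding sum rhs using bound[OF u'] 1 2 by linarith
    ultimately show ?thesis by blast
  qed
  have "\<bar>s * L\<bar> \<le> 4 * l (Suc m)" unfolding s_def using L by (simp add: abs_mult)
  then show ?case using key by (intro exI[of _ K'] exI[of _ "s * L"] conjI allI impI) auto
qed

section \<open>The polytope\<close>

lemma lookup_scaleR [simp]: "Poly_Mapping.lookup (k *\<^sub>R x) j = k *\<^sub>R Poly_Mapping.lookup x j"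
proof -
  have "finite {i. k *\<^sub>R Poly_Mapping.lookup x i \<noteq> 0}"
    by (rule finite_subset[OF _ finite_lookup[of x]]) auto
  then show ?thesis unfolding scaleR_poly_mapping_def by simp
qed

lemma affine_fun_const [intro]: "affine_fun (\<lambda>x. k)"
  by (simp add: affine_fun_def)

lemma affine_fun_add [intro]: "affine_fun f \<Longrightarrow> affine_fun g \<Longrightarrow> affine_fun (\<lambda>x. f x + g x)"
  by (subst affine_fun_def) (auto simp add: affine_funD, simp add: algebra_simps)

lemma affine_fun_cmult [intro]: "affine_fun f \<Longrightarrow> affine_fun (\<lambda>x. k * f x)"
  by (subst affine_fun_def) (auto simp add: affine_funD, simp add: algebra_simps)

lemma affine_fun_diff [intro]: "affine_fun f \<Longrightarrow> affine_fun g \<Longrightarrow> affine_fun (\<lambda>x. f x - g x)"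
  using affine_fun_add[OF _ affine_fun_cmult[of g "- 1"], of f] by simp

lemma affine_fun_multc [intro]: "affine_fun f \<Longrightarrow> affine_fun (\<lambda>x. f x * k)"
  using affine_fun_cmult[of f k] by (simp add: mult.commute)

lemma affine_fun_divide [intro]: "affine_fun f \<Longrightarrow> affine_fun (\<lambda>x. f x / k)"
  using affine_fun_multc[of f "1 / k"] by simp

lemma affine_fun_lookup [intro]: "affine_fun (\<lambda>x :: nat \<Rightarrow>\<^sub>0 real. Poly_Mapping.lookup x j)"
  by (simp add: affine_fun_def lookup_add lookup_minus)

lemma affine_fun_sum [intro]:
  "(\<And>j. j \<in> J \<Longrightarrow> affine_fun (f j)) \<Longrightarrow> affine_fun (\<lambda>x. \<Sum>j\<in>J. f j x)"
  by (induction J rule: infinite_finite_induct) auto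

section \<open>Coordinates of the patches and the defining inequalities\<close>

definition mean :: "nat \<Rightarrow> (nat \<Rightarrow>\<^sub>0 real) \<Rightarrow> real" where
  "mean d x = (\<Sum>j\<le>d. Poly_Mapping.lookup x j) / (real d + 1)"

definition dev :: "nat \<Rightarrow> (nat \<Rightarrow>\<^sub>0 real) \<Rightarrow> nat \<Rightarrow> real" where
  "dev d x j = Poly_Mapping.lookup x j - mean d x"

text \<open>The lines \<open>rad i\<close> are tangents to \<open>t \<mapsto> 2 * sqrt t\<close>, at \<open>t = 32 ^ (2 * i)\<close>: near this
  value of \<open>t\<close> the radius \<open>rad i t\<close> is much smaller than all the other ones.\<close>

definition rad :: "nat \<Rightarrow> real \<Rightarrow> real" where
  "rad i t = 32 ^ i + t / 32 ^ i"

text \<open>For \<open>r < d\<close> and \<open>i \<le> d\<close> this is \<open>i + r + 1\<close> modulo \<open>d + 1\<close>.\<close>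

definition rot :: "nat \<Rightarrow> nat \<Rightarrow> nat \<Rightarrow> nat" where
  "rot d i r = (if i + Suc r \<le> d then i + Suc r else i + r - d)"

text \<open>The multiple of \<open>dev d x i\<close> has the effect of raising every weight of the
  objective by \<open>S / d\<close>, see \<open>dot_eq_tilt\<close>; weights thus stay positive
  where \<open>w\<close> ties with its minimum.\<close>

definition tilt :: "nat \<Rightarrow> nat \<Rightarrow> (nat \<Rightarrow>\<^sub>0 real) \<Rightarrow> nat \<Rightarrow> real" where
  "tilt d i x r = dev d x (rot d i r) + dev d x i / (2 * real d)"

text \<open>The powers of \<open>8 * (real d + 1)\<close> produce the growth of the weights. The
  last level runs from \<open>0\<close> to \<open>1\<close> as the mean goes from
  \<open>(32 ^ i)\<^sup>2\<close> to twice that value.\<close>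

definition level :: "nat \<Rightarrow> nat \<Rightarrow> (nat \<Rightarrow>\<^sub>0 real) \<Rightarrow> nat \<Rightarrow> real" where
  "level d i x r = (if r < d then (tilt d i x r - rad i (mean d x)) * (8 * (real d + 1)) ^ (d - r)
     else mean d x / (32 ^ i)\<^sup>2 - 1)"

datatype ineq = Up nat nat | Down nat nat | Cap nat | Top

primrec ineq_fun :: "nat \<Rightarrow> ineq \<Rightarrow> (nat \<Rightarrow>\<^sub>0 real) \<Rightarrow> real" where
  "ineq_fun d (Up i r) x = level d i x r - 2 * level d i x (Suc r)"
| "ineq_fun d (Down i r) x = level d i x r + 2 * level d i x (Suc r) - 2"
| "ineq_fun d (Cap i) x = dev d x i - rad i (mean d x)"
| "ineq_fun d Top x = mean d x - 2 * (32 ^ d)\<^sup>2"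

definition ineqs :: "nat \<Rightarrow> ineq set" where
  "ineqs d = insert Top (Cap ` {..d} \<union>
     ((\<lambda>(i, r). Up i r) ` ({..d} \<times> {..<d}) \<union> (\<lambda>(i, r). Down i r) ` ({..d} \<times> {..<d})))"

lemma finite_ineqs: "finite (ineqs d)"
  unfolding ineqs_def by simp

lemma card_ineqs: "card (ineqs d) = (2 * d + 1) * (d + 1) + 1"
proof -
  let ?U = "(\<lambda>(i, r). Up i r) ` ({..d} \<times> {..<d})"
  let ?D = "(\<lambda>(i, r). Down i r) ` ({..d} \<times> {..<d})"
  have "card ?U = Suc d * d" "card ?D = Suc d * d" "card (Cap ` {..d}) = Suc d"
    by (subst card_image; auto simp: inj_on_def card_cartesian_product)+
  moreover have "?U \<inter> ?D = {}" "Cap ` {..d} \<inter> (?U \<union> ?D) = {}" by auto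
  ultimately have "card (Cap ` {..d} \<union> (?U \<union> ?D)) = Suc d + (Suc d * d + Suc d * d)"
    by (subst card_Un_disjoint; simp add: card_Un_disjoint)
  moreover have "Top \<notin> Cap ` {..d} \<union> (?U \<union> ?D)" by auto
  ultimately show ?thesis unfolding ineqs_def by (subst card_insert_disjoint) (auto simp: algebra_simps)
qed

lemma ineqs_iff:
  "(\<forall>a\<in>ineqs d. Q a) \<longleftrightarrow> Q Top \<and> (\<forall>i\<le>d. Q (Cap i) \<and> (\<forall>r<d. Q (Up i r) \<and> Q (Down i r)))"
  unfolding ineqs_def by auto

lemma affine_fun_mean [intro]: "affine_fun (mean d)"
  unfolding mean_def by (intro affine_fun_divide affine_fun_sum affine_fun_lookup)

lemma affine_fun_dev [intro]: "affine_fun (\<lambda>x. dev d x j)"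
  unfolding dev_def by (intro affine_fun_diff affine_fun_lookup affine_fun_mean)

lemma affine_fun_rad [intro]: "affine_fun (\<lambda>x. rad j (mean d x))"
  unfolding rad_def by (intro affine_fun_add affine_fun_const affine_fun_divide affine_fun_mean)

lemma affine_fun_level [intro]: "affine_fun (\<lambda>x. level d i x r)"
  unfolding level_def tilt_def
  by (cases "r < d") (auto intro!: affine_fun_add affine_fun_const affine_fun_divide affine_fun_mean
      affine_fun_diff affine_fun_multc affine_fun_dev affine_fun_rad)

lemma affine_fun_ineq: "affine_fun (ineq_fun d a)"
  by (subst ineq_fun_def)
    (cases a; auto intro!: affine_fun_add affine_fun_diff affine_fun_const affine_fun_cmult)

lemma in_coord_space_iff: "x \<in> coord_space (Suc d) \<longleftrightarrow> (\<forall>j>d. Poly_Mapping.lookup x j = 0)"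
  unfolding coord_space_def by (auto simp: in_keys_iff subset_iff not_less less_Suc_eq_le)

lemma subspace_coord_space: "subspace (coord_space (Suc d))"
  unfolding subspace_def by (auto simp: in_coord_space_iff lookup_add)

interpretation ineq: affine_system "coord_space (Suc d)" "ineqs d" "ineq_fun d" for d
  by unfold_locales (auto simp: subspace_coord_space finite_ineqs affine_fun_ineq)

definition stack_polytope :: "nat \<Rightarrow> (nat \<Rightarrow>\<^sub>0 real) set" where
  "stack_polytope d = ineq.feasible d"

section \<open>Recovering a point from its mean and its tilts\<close>

lemma sum_rot:
  fixes f :: "nat \<Rightarrow> real"
  assumes "i \<le> d"
  shows "(\<Sum>j\<le>d. f j) = f i + (\<Sum>r<d. f (rot d i r))"
proof -
  have "(\<Sum>j\<in>{..d} - {i}. f j) = (\<Sum>r<d. f (rot d i r))"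
    by (rule sum.reindex_bij_witness[of _ "rot d i" "\<lambda>j. if i < j then j - i - 1 else j + d - i"])
      (use assms in \<open>auto simp: rot_def\<close>)
  then show ?thesis using assms by (simp add: sum.remove[of "{..d}" i])
qed

lemma rot_le: "i \<le> d \<Longrightarrow> r < d \<Longrightarrow> rot d i r \<le> d"
  by (auto simp: rot_def)

lemma rot_cases:
  assumes "i \<le> d" "j \<le> d"
  obtains "j = i" | r where "r < d" "j = rot d i r"
proof (cases i j rule: linorder_cases)
  case less
  then show thesis using assms that(2)[of "j - i - 1"] by (auto simp: rot_def)
next
  case greater
  then show thesis using assms that(2)[of "j + d - i"] by (auto simp: rot_def)
qed (use that in auto)

lemma sum_lookup_eq_mean: "(\<Sum>j\<le>d. Poly_Mapping.lookup x j) = (real d + 1) * mean d x"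
  unfolding mean_def by (simp add: add_nonneg_eq_0_iff)

lemma sum_dev: "(\<Sum>j\<le>d. dev d x j) = 0"
  unfolding dev_def by (simp add: sum_subtractf sum_lookup_eq_mean algebra_simps)

lemma dev_eq_sum_tilt:
  assumes "i \<le> d" "0 < d"
  shows "dev d x i = - 2 * (\<Sum>r<d. tilt d i x r)"
  using sum_rot[OF assms(1), of "dev d x"] sum_dev[of d x] assms(2)
  unfolding tilt_def by (simp add: sum.distrib)

lemma tilt_eq_level:
  "r < d \<Longrightarrow> tilt d i x r = rad i (mean d x) + level d i x r / (8 * (real d + 1)) ^ (d - r)"
  unfolding level_def by (simp add: add_nonneg_eq_0_iff)

text \<open>The levels of one patch are affine coordinates: level \<open>d\<close> yields the mean,
  the others the tilts, the sum of the tilts yields \<open>dev d x i\<close>, and this the remaining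
  deviations.\<close>

lemma eq_of_levels:
  assumes d: "0 < d" "i \<le> d" and x: "x \<in> coord_space (Suc d)" "y \<in> coord_space (Suc d)"
    and eq: "\<And>r. r \<le> d \<Longrightarrow> level d i x r = level d i y r"
  shows "x = y"
proof (rule poly_mapping_eqI)
  fix j
  have m: "mean d x = mean d y" using eq[of d] unfolding level_def by simp
  have t: "tilt d i x r = tilt d i y r" if "r < d" for r
    using that eq[of r] m by (simp add: tilt_eq_level)
  have di: "dev d x i = dev d y i" using t by (simp add: dev_eq_sum_tilt d)
  show "Poly_Mapping.lookup x j = Poly_Mapping.lookup y j"
  proof (cases "j \<le> d")
    case True
    have "dev d x j = dev d y j"
      using rot_cases[OF d(2) True] by cases (use di t in \<open>auto simp: tilt_def\<close>)
    then show ?thesis using m unfolding dev_def by simp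
  qed (use x in \<open>auto simp: in_coord_space_iff\<close>)
qed

lemma exists_point:
  assumes d: "0 < d" "i \<le> d"
  obtains x where "x \<in> coord_space (Suc d)" "mean d x = t" "\<And>r. r < d \<Longrightarrow> tilt d i x r = g r"
proof -
  define G where "G = (\<Sum>r<d. g r)"
  \<comment> \<open>Tilts with sum \<open>G\<close> force the deviation \<open>- 2 * G\<close> at
    \<open>i\<close>; it contributes \<open>- G / d\<close> to each tilt, which the other entries
    compensate.\<close>
  define k where "k j = t + (if j = i then - 2 * G else
     G / d + g (if i < j then j - i - 1 else j + d - i))" for j
  define x :: "nat \<Rightarrow>\<^sub>0 real" where "x = (\<Sum>j\<le>d. Poly_Mapping.single j (k j))"
  have "Poly_Mapping.lookup x j = (\<Sum>l\<le>d. if l = j then k l else 0)" for j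
    unfolding x_def by (auto simp: lookup_sum lookup_single when_def intro!: sum.cong)
  then have lx: "Poly_Mapping.lookup x j = (if j \<le> d then k j else 0)" for j
    by simp
  have kr: "k (rot d i r) = t + G / d + g r" if "r < d" for r
    using that d unfolding k_def rot_def by auto
  have "(\<Sum>j\<le>d. k j) = k i + (\<Sum>r<d. t + G / d + g r)"
    using kr by (simp add: sum_rot[OF d(2)])
  also have "\<dots> = (real d + 1) * t"
    using d(1) unfolding k_def by (simp add: sum.distrib G_def[symmetric] algebra_simps)
  finally have m: "mean d x = t" unfolding mean_def by (simp add: lx)
  have "tilt d i x r = g r" if "r < d" for r
    unfolding tilt_def dev_def m lx using kr[OF that] rot_le[OF d(2) that] d
    by (simp add: k_def)
  moreover have "x \<in> coord_space (Suc d)" unfolding in_coord_space_iff lx by simp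
  ultimately show thesis using m that by blast
qed

section \<open>Separation of the patches\<close>

definition slack_patch :: "nat \<Rightarrow> (nat \<Rightarrow>\<^sub>0 real) \<Rightarrow> nat \<Rightarrow> bool" where
  "slack_patch d x i \<longleftrightarrow> ineq_fun d (Cap i) x < 0 \<and>
     (\<forall>r<d. ineq_fun d (Up i r) x < 0 \<and> ineq_fun d (Down i r) x < 0)"

lemma rad_ge_1: "0 \<le> t \<Longrightarrow> 1 \<le> rad i t"
  unfolding rad_def using one_le_power[of "32::real" i] by (simp add: add_increasing2)

text \<open>All tilts stay below the radius \<open>R\<close> by an amount between
  \<open>R / 2\<close> and \<open>(real d + 1) * R\<close>. The scaling factor between consecutive
  levels exceeds twice the ratio of these bounds, so below level \<open>d\<close> the levels are
  negative and each is less than twice the next one.\<close>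

lemma slack_patchI:
  assumes d: "0 < d" "i \<le> d" and t: "0 < mean d x"
    and Z: "0 < Z" "4 * Z \<le> rad i (mean d x)" "\<And>j. j \<le> d \<Longrightarrow> dev d x j \<le> Z"
  shows "slack_patch d x i"
proof -
  define R where "R = rad i (mean d x)"
  define B where "B = 8 * (real d + 1)"
  have R: "1 \<le> R" "4 * Z \<le> R" unfolding R_def using rad_ge_1 t Z by auto
  \<comment> \<open>The deviations sum to zero, so a common upper bound also bounds them from
    below.\<close>
  have low: "dev d x j \<ge> - real d * Z" if "j \<le> d" for j
  proof -
    have "(\<Sum>r<d. dev d x (rot d j r)) \<le> (\<Sum>r<d. Z)"
      using rot_le[OF that] Z(3) by (intro sum_mono) auto
    then show ?thesis using sum_rot[OF that, of "dev d x"] sum_dev[of d x] by simp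
  qed
  define e where "e r = tilt d i x r - R" for r
  have e: "e r \<le> - R / 2" "e r \<ge> - (real d + 1) * R" if "r < d" for r
  proof -
    note j = rot_le[OF d(2) that]
    have "dev d x i / (2 * real d) \<le> Z / 2"
      using Z(3)[OF d(2)] d(1) Z(1) by (simp add: field_simps) (smt (verit) mult_le_cancel_left1 of_nat_1 of_nat_le_iff Suc_leI One_nat_def)
    then show "e r \<le> - R / 2" unfolding e_def tilt_def using Z(3)[OF j] R Z(1) by simp
    have "dev d x i / (2 * real d) \<ge> - Z / 2"
      using low[OF d(2)] d(1) by (simp add: field_simps)
    moreover have "real d * Z \<le> real d * (R / 4)" using R by (intro mult_left_mono) auto
    moreover have "R \<le> real d * R" using mult_right_mono[of 1 "real d" R] d(1) R by simp
    moreover have "dev d x (rot d i r) \<ge> - (real d * Z)" using low[OF j] by simp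
    ultimately show "e r \<ge> - (real d + 1) * R"
      unfolding e_def tilt_def distrib_right minus_mult_left[symmetric] using R by linarith
  qed
  have lev: "level d i x r = e r * B ^ (d - r)" if "r < d" for r
    using that unfolding level_def e_def B_def R_def by simp
  have B: "B > 0" unfolding B_def by simp
  have eB: "e r * B \<le> - 4 * (real d + 1) * R" if "r < d" for r
    using mult_right_mono[OF e(1)[OF that], of B] B unfolding B_def by (simp add: algebra_simps)
  have neg: "level d i x r < 0" if "r < d" for r
    unfolding lev[OF that] using e(1)[OF that] R B by (intro mult_neg_pos) auto
  have "level d i x r < 2 * level d i x (Suc r) \<and> level d i x r < 2 - 2 * level d i x (Suc r)"
    if r: "r < d" for r
  proof (cases "Suc r < d")
    case True
    have "e r * B < 2 * e (Suc r)"
    proof -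
      have "2 * (real d + 1) * R > 0" using R by simp
      then show ?thesis using eB[OF r] e(2)[OF True] by (simp add: algebra_simps)
    qed
    then have "e r * B * B ^ (d - Suc r) < 2 * e (Suc r) * B ^ (d - Suc r)"
      using B by (intro mult_strict_right_mono) auto
    moreover have "B * B ^ (d - Suc r) = B ^ (d - r)"
      using r by (metis Suc_diff_Suc power_Suc)
    ultimately have "level d i x r < 2 * level d i x (Suc r)"
      unfolding lev[OF r] lev[OF True] by (simp add: mult.assoc)
    then show ?thesis using neg[OF r] neg[OF True] by simp
  next
    case False
    then have Sr: "Suc r = d" using r by simp
    then have "level d i x r = e r * B" using lev[OF r] by (auto simp: Suc_diff_le)
    moreover have "4 * (real d + 1) * R \<ge> 8 * R" using d(1) R by (intro mult_right_mono) auto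
    ultimately have 1: "level d i x r \<le> - 8 * R" using eB[OF r] by (simp add: algebra_simps)
    \<comment> \<open>Level \<open>d\<close> may have either sign, but it lies between
      \<open>-1\<close> and \<open>R\<close>, whereas level \<open>d - 1\<close> is at most
      \<open>- 8 * R\<close>.\<close>
    have 2: "level d i x (Suc r) = mean d x / (32 ^ i)\<^sup>2 - 1" unfolding Sr level_def by simp
    have "mean d x / (32 ^ i)\<^sup>2 \<le> mean d x / 32 ^ i"
      using t self_le_power[of "32 ^ i :: real" 2] by (intro divide_left_mono) auto
    also have "\<dots> \<le> R" unfolding R_def rad_def by simp
    finally have "mean d x / (32 ^ i)\<^sup>2 \<le> R" .
    moreover have "mean d x / (32 ^ i)\<^sup>2 > 0" using t by simp
    ultimately show ?thesis using 1 2 R by simp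
  qed
  moreover have "dev d x i < R" using Z(3)[OF d(2)] R Z(1) by simp
  ultimately show ?thesis unfolding slack_patch_def R_def by (simp add: algebra_simps)
qed

text \<open>Each term of \<open>rad j t\<close> is responsible for one side: the constant term is
  large for \<open>j > i\<close>, the linear one for \<open>j < i\<close>.\<close>

lemma rad_separated:
  assumes "i \<noteq> j" "(32 ^ i)\<^sup>2 \<le> t"
  shows "32 * 32 ^ i \<le> rad j t"
proof (cases "i < j")
  case True
  then have "(32::real) ^ Suc i \<le> 32 ^ j" by (intro power_increasing) auto
  moreover have "t / 32 ^ j \<ge> 0"
    using order_trans[OF zero_le_power2 assms(2)] by simp
  ultimately show ?thesis unfolding rad_def by simp
next
  case False
  then have "Suc j \<le> i" using assms(1) by simp
  then have "(32::real) ^ Suc j \<le> 32 ^ i" by (intro power_increasing) auto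
  then have "(32::real) ^ Suc j * 32 ^ i \<le> 32 ^ i * 32 ^ i" by (intro mult_right_mono) auto
  also have "\<dots> \<le> t" using assms(2) by (simp add: power2_eq_square)
  finally have "32 * 32 ^ i \<le> t / 32 ^ j" by (simp add: pos_le_divide_eq algebra_simps)
  then show ?thesis unfolding rad_def by (simp add: add_increasing)
qed

lemma slack_other_patches:
  assumes d: "0 < d" "i \<le> d" "j \<le> d" "j \<noteq> i" and t: "(32 ^ i)\<^sup>2 \<le> mean d x"
    and Z: "\<And>k. k \<le> d \<Longrightarrow> dev d x k \<le> 8 * 32 ^ i"
  shows "slack_patch d x j"
proof (rule slack_patchI[OF d(1,3), of _ "8 * 32 ^ i"])
  have "(0::real) < (32 ^ i)\<^sup>2" by simp
  then show "0 < mean d x" using t by linarith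
  show "4 * (8 * 32 ^ i) \<le> rad j (mean d x)" using rad_separated[OF d(4)[symmetric] t] by simp
qed (use Z in auto)

text \<open>The prescribed last level puts the mean between \<open>(32 ^ i)\<^sup>2\<close> and
  twice that value, where the radius is at most \<open>3 * 32 ^ i\<close>. The tilts are then at
  most \<open>4 * 32 ^ i\<close> and the deviations at most \<open>8 * 32 ^ i\<close>, as
  \<open>slack_other_patches\<close> requires.\<close>

lemma exists_level_point:
  assumes d: "0 < d" "i \<le> d" and u: "\<And>r. r \<le> d \<Longrightarrow> 0 < u r" "\<And>r. r \<le> d \<Longrightarrow> u r \<le> 1" "u d < 1"
  obtains x where "x \<in> coord_space (Suc d)" "\<And>r. r \<le> d \<Longrightarrow> level d i x r = u r"
    "ineq_fun d Top x < 0" "ineq_fun d (Cap i) x < 0"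
    "\<And>j. j \<le> d \<Longrightarrow> j \<noteq> i \<Longrightarrow> slack_patch d x j"
proof -
  define t where "t = (32 ^ i)\<^sup>2 * (1 + u d)"
  define R where "R = rad i t"
  define B where "B = 8 * (real d + 1)"
  define g where "g r = R + u r / B ^ (d - r)" for r
  obtain x where x: "x \<in> coord_space (Suc d)" "mean d x = t" "\<And>r. r < d \<Longrightarrow> tilt d i x r = g r"
    using exists_point[OF d] by blast
  have ud: "0 < u d" "u d < 1" using u by auto
  have t1: "(32 ^ i)\<^sup>2 \<le> t" unfolding t_def using ud by simp
  have t2: "t < 2 * (32 ^ i)\<^sup>2" unfolding t_def using ud by simp
  have t0: "0 \<le> t" using t1 by (meson order_trans zero_le_power2)
  have R: "1 \<le> R" unfolding R_def using rad_ge_1[OF t0] .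
  have "t / 32 ^ i \<le> 2 * 32 ^ i" using t2 by (simp add: pos_divide_le_eq power2_eq_square)
  then have R3: "R \<le> 3 * 32 ^ i" unfolding R_def rad_def by simp
  have B: "B \<ge> 1" unfolding B_def by simp
  have g: "0 < g r" "g r \<le> 4 * 32 ^ i" if "r < d" for r
  proof -
    have "0 < u r / B ^ (d - r)" using u(1)[of r] that B by simp
    moreover have "u r / B ^ (d - r) \<le> 1"
      using order_trans[OF u(2)[of r] one_le_power[OF B, of "d - r"]] that B
      by (simp add: divide_le_eq_1)
    moreover have "(1::real) \<le> 32 ^ i" by simp
    ultimately show "0 < g r" "g r \<le> 4 * 32 ^ i" unfolding g_def using R R3 by linarith+
  qed
  have di: "dev d x i = - 2 * (\<Sum>r<d. g r)" using dev_eq_sum_tilt[OF d(2,1)] x(3) by simp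
  have G: "0 \<le> (\<Sum>r<d. g r)" using g(1) by (intro sum_nonneg) (auto intro: less_imp_le)
  have "(\<Sum>r<d. g r) \<le> (\<Sum>r<d. 4 * 32 ^ i)" using g(2) by (intro sum_mono) auto
  then have "(\<Sum>r<d. g r) / d \<le> 4 * 32 ^ i" using d(1) by (simp add: field_simps)
  then have dr: "dev d x (rot d i r) \<le> 8 * 32 ^ i" if "r < d" for r
    using x(3)[OF that] g(2)[OF that] di d(1) unfolding tilt_def by simp
  have Z: "dev d x k \<le> 8 * 32 ^ i" if "k \<le> d" for k
  proof -
    have "dev d x i \<le> 8 * 32 ^ i" using di G
      by (smt (verit) zero_less_power)
    then show ?thesis using rot_cases[OF d(2) that] dr by metis
  qed
  have "level d i x r = u r" if "r \<le> d" for r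
  proof (cases "r < d")
    case True
    then show ?thesis using B unfolding level_def x(2) R_def[symmetric] x(3)[OF True] g_def B_def
      by simp
  next
    case False
    then show ?thesis using that x(2) unfolding level_def t_def by simp
  qed
  moreover have "ineq_fun d Top x < 0"
  proof -
    have "(32 ^ i :: real) \<le> 32 ^ d" using d(2) by (intro power_increasing) auto
    then have "(32 ^ i :: real)\<^sup>2 \<le> (32 ^ d)\<^sup>2" by (intro power_mono) auto
    then have "t < 2 * (32 ^ d)\<^sup>2" using t2 by linarith
    then show ?thesis using x(2) by simp
  qed
  moreover have "ineq_fun d (Cap i) x < 0" using di G R x(2) unfolding R_def by simp
  moreover have "slack_patch d x j" if "j \<le> d" "j \<noteq> i" for j
    using slack_other_patches[OF d that] x(2) t1 Z by simp
  ultimately show thesis using that x(1) by blast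
qed

lemma mem_stack_polytope:
  "x \<in> stack_polytope d \<longleftrightarrow> x \<in> coord_space (Suc d) \<and> (\<forall>a\<in>ineqs d. ineq_fun d a x \<le> 0)"
  unfolding stack_polytope_def ineq.feasible_def by simp

lemma tent_chain_level:
  assumes "x \<in> stack_polytope d" "i \<le> d"
  shows "tent_chain d (level d i x)"
proof -
  have "ineq_fun d (Up i r) x \<le> 0 \<and> ineq_fun d (Down i r) x \<le> 0" if "r < d" for r
    using assms that unfolding mem_stack_polytope ineqs_iff by blast
  then show ?thesis unfolding tent_chain_def by force
qed

section \<open>Affine bases, boundedness and facets of the polytope\<close>

definition axis_basis :: "nat \<Rightarrow> (nat \<Rightarrow>\<^sub>0 real) set" where
  "axis_basis d = (\<lambda>j. Poly_Mapping.single j 1) ` {..d}"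

lemma independent_axis_basis: "independent (axis_basis d)"
proof
  assume "dependent (axis_basis d)"
  then obtain j where j: "j \<le> d"
      "Poly_Mapping.single j (1::real) \<in> span (axis_basis d - {Poly_Mapping.single j 1})"
    unfolding dependent_def axis_basis_def by blast
  have "subspace {x :: nat \<Rightarrow>\<^sub>0 real. Poly_Mapping.lookup x j = 0}"
    unfolding subspace_def by (auto simp: lookup_add)
  moreover have "axis_basis d - {Poly_Mapping.single j 1} \<subseteq> {x. Poly_Mapping.lookup x j = 0}"
    unfolding axis_basis_def by (auto simp: lookup_single when_def)
  ultimately have "span (axis_basis d - {Poly_Mapping.single j 1}) \<subseteq> {x. Poly_Mapping.lookup x j = 0}"
    by (rule span_minimal[rotated])
  then show False using j(2) by auto
qed

lemma span_axis_basis: "span (axis_basis d) = coord_space (Suc d)"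
proof
  show "span (axis_basis d) \<subseteq> coord_space (Suc d)"
    using subspace_coord_space unfolding axis_basis_def
    by (intro span_minimal) (auto simp: in_coord_space_iff lookup_single when_def)
  show "coord_space (Suc d) \<subseteq> span (axis_basis d)"
  proof
    fix x assume x: "x \<in> coord_space (Suc d)"
    have "x = (\<Sum>j\<le>d. Poly_Mapping.lookup x j *\<^sub>R Poly_Mapping.single j 1)"
    proof (rule poly_mapping_eqI)
      fix k
      have "Poly_Mapping.lookup (\<Sum>j\<le>d. Poly_Mapping.lookup x j *\<^sub>R Poly_Mapping.single j 1) k
          = (\<Sum>j\<le>d. Poly_Mapping.lookup x j * (if j = k then 1 else 0))"
        by (simp add: lookup_sum lookup_single when_def)
      also have "\<dots> = (\<Sum>j\<le>d. if j = k then Poly_Mapping.lookup x j else 0)"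
        by (intro sum.cong refl) simp
      finally have sum_eq: "Poly_Mapping.lookup (\<Sum>j\<le>d. Poly_Mapping.lookup x j *\<^sub>R Poly_Mapping.single j 1) k
          = (\<Sum>j\<le>d. if j = k then Poly_Mapping.lookup x j else 0)" .
      then show "Poly_Mapping.lookup x k =
          Poly_Mapping.lookup (\<Sum>j\<le>d. Poly_Mapping.lookup x j *\<^sub>R Poly_Mapping.single j 1) k"
        unfolding sum_eq using x by (auto simp: in_coord_space_iff)
    qed
    also have "\<dots> \<in> span (axis_basis d)"
      unfolding axis_basis_def by (intro span_sum span_scale span_base) auto
    finally show "x \<in> span (axis_basis d)" .
  qed
qed

lemma affine_axis_basis:
  "finite (insert 0 (axis_basis d))" "\<not> affine_dependent (insert 0 (axis_basis d))"
  "affine hull (insert 0 (axis_basis d)) = coord_space (Suc d)"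
  "card (insert 0 (axis_basis d)) = d + 2"
proof -
  show "finite (insert 0 (axis_basis d))" unfolding axis_basis_def by simp
  show "\<not> affine_dependent (insert 0 (axis_basis d))"
    using affine_dependent_imp_dependent2 independent_axis_basis by blast
  show "affine hull (insert 0 (axis_basis d)) = coord_space (Suc d)"
    using affine_hull_span_0[of "insert 0 (axis_basis d)"] span_axis_basis
    by (simp add: hull_inc span_insert_0)
  have "inj_on (\<lambda>j. Poly_Mapping.single j (1::real)) {..d}"
    by (rule inj_onI) (metis lookup_single_eq lookup_single_not_eq zero_neq_one)
  moreover have "0 \<notin> axis_basis d" using independent_axis_basis dependent_zero by blast
  ultimately show "card (insert 0 (axis_basis d)) = d + 2"
    unfolding axis_basis_def by (simp add: card_image)
qed

text \<open>Bounds are read off from patch \<open>0\<close>, \<open>Cap 0\<close> and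
  \<open>Top\<close>. The tilts are at most \<open>R + 1\<close> and sum to
  \<open>- dev d x 0 / 2\<close>, so \<open>Cap 0\<close> keeps \<open>R\<close> above
  \<open>-1\<close> and the mean is bounded below. Upper bounds on all coordinates and a lower bound
  on their sum then give lower bounds on each.\<close>

lemma polytope_stack_polytope:
  assumes d: "0 < d"
  shows "polytope (stack_polytope d)"
proof -
  define K where "K = 2 * (32 ^ d)\<^sup>2 + (2::real)"
  have K: "2 \<le> K" unfolding K_def by simp
  have up: "Poly_Mapping.lookup x j \<le> 4 * K" and low: "- (real d + 1) * (4 * K) \<le> mean d x"
    if x: "x \<in> stack_polytope d" and j: "j \<le> d" for x j
  proof -
    define R where "R = rad 0 (mean d x)"
    have R: "R = 1 + mean d x" unfolding R_def rad_def by simp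
    have chain: "tent_chain d (level d 0 x)" using tent_chain_level[OF x] by simp
    have t: "tilt d 0 x r \<le> R + 1" if r: "r < d" for r
    proof -
      have "level d 0 x r \<le> 1" using chain r unfolding tent_chain_def by force
      moreover have "(1::real) \<le> (8 * (real d + 1)) ^ (d - r)" by (intro one_le_power) simp
      ultimately have "level d 0 x r / (8 * (real d + 1)) ^ (d - r) \<le> 1"
        by (subst divide_le_eq_1_pos) (auto intro: order_trans simp del: power_Suc)
      then show ?thesis unfolding tilt_eq_level[OF r] R_def by simp
    qed
    have "ineq_fun d (Cap 0) x \<le> 0" "ineq_fun d Top x \<le> 0"
      using x unfolding mem_stack_polytope ineqs_iff by blast+
    then have d0: "dev d x 0 \<le> R" and m: "mean d x \<le> K - 2" unfolding R_def K_def by simp_all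
    have "(\<Sum>r<d. tilt d 0 x r) \<le> (\<Sum>r<d. R + 1)" using t by (intro sum_mono) auto
    then have s: "- dev d x 0 / 2 \<le> real d * (R + 1)"
      using dev_eq_sum_tilt[of 0 d x] d by simp
    then have "0 \<le> (real d + 1/2) * R + real d" using d0 by (simp add: algebra_simps)
    have R1: "R \<ge> -1"
    proof (rule ccontr)
      assume "\<not> R \<ge> -1"
      then have "(real d + 1/2) * R \<le> (real d + 1/2) * (-1)" by (intro mult_left_mono) auto
      with \<open>0 \<le> (real d + 1/2) * R + real d\<close> show False by simp
    qed
    have "- dev d x 0 / (2 * real d) \<le> R + 1"
      using s d by (simp add: field_simps)
    then have "dev d x (rot d 0 r) \<le> 2 * (R + 1)" if "r < d" for r
      using t[OF that] unfolding tilt_def by simp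
    moreover have "dev d x 0 \<le> 2 * (R + 1)" using d0 R1 by simp
    ultimately have "dev d x j \<le> 2 * (R + 1)" using rot_cases[OF le0 j] by metis
    then show "Poly_Mapping.lookup x j \<le> 4 * K" using m R K unfolding dev_def by simp
    have "(real d + 1) * (4 * K) \<ge> 1 * (4 * K)" using K by (intro mult_right_mono) auto
    then show "- (real d + 1) * (4 * K) \<le> mean d x" unfolding mult_minus_left using R R1 K by linarith
  qed
  have low': "- (real d + 1) * (real d + 1) * (4 * K) - real d * (4 * K) \<le> Poly_Mapping.lookup x j"
    if x: "x \<in> stack_polytope d" and j: "j \<le> d" for x j
  proof -
    have "(real d + 1) * mean d x = (\<Sum>k\<le>d. Poly_Mapping.lookup x k)"
      by (simp add: sum_lookup_eq_mean)
    also have "\<dots> = Poly_Mapping.lookup x j + (\<Sum>r<d. Poly_Mapping.lookup x (rot d j r))"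
      using sum_rot[OF j] .
    also have "(\<Sum>r<d. Poly_Mapping.lookup x (rot d j r)) \<le> (\<Sum>r<d. 4 * K)"
      using up[OF x] rot_le[OF j] by (intro sum_mono) auto
    finally have 1: "(real d + 1) * mean d x \<le> Poly_Mapping.lookup x j + real d * (4 * K)" by simp
    have "(real d + 1) * (- (real d + 1) * (4 * K)) \<le> (real d + 1) * mean d x"
      using low[OF x j] by (intro mult_left_mono) auto
    with 1 show ?thesis by (simp add: algebra_simps)
  qed
  define M where "M = (real d + 1) * (real d + 1) * (4 * K) + real d * (4 * K) + 4 * K"
  have nonneg: "0 \<le> (real d + 1) * (real d + 1) * (4 * K)" "0 \<le> real d * (4 * K)" using K by simp_all
  have M: "\<bar>Poly_Mapping.lookup x j\<bar> \<le> M" if "x \<in> stack_polytope d" "j \<le> d" for x j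
    using up[OF that] low'[OF that] K nonneg unfolding M_def abs_le_iff mult_minus_left by linarith
  show ?thesis unfolding stack_polytope_def
  proof (rule ineq.polytope_feasible)
    fix x u assume x: "x \<in> ineq.feasible d" and u: "u \<in> coord_space (Suc d)" "u \<noteq> 0"
    then obtain j where j: "j \<le> d" "Poly_Mapping.lookup u j \<noteq> 0"
      by (metis in_coord_space_iff lookup_zero not_le poly_mapping_eqI)
    define t where "t = (2 * M + 1) / \<bar>Poly_Mapping.lookup u j\<bar>"
    have Mj: "\<bar>Poly_Mapping.lookup x j\<bar> \<le> M" using M[OF _ j(1), of x] x unfolding stack_polytope_def by blast
    then have t: "t > 0" unfolding t_def using j(2) by (intro divide_pos_pos) auto
    have "\<bar>t * Poly_Mapping.lookup u j\<bar> = 2 * M + 1"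
      using t j(2) Mj unfolding t_def by (simp add: abs_mult)
    then have "\<bar>Poly_Mapping.lookup (x + t *\<^sub>R u) j\<bar> > M" using Mj by (simp add: lookup_add)
    then have "x + t *\<^sub>R u \<notin> ineq.feasible d"
      using M[OF _ j(1), of "x + t *\<^sub>R u"] unfolding stack_polytope_def by auto
    with t show "\<exists>t>0. x + t *\<^sub>R u \<notin> ineq.feasible d" by blast
  qed
qed

text \<open>Multiples of the all-ones vector at positive height leave all patches slack; they
  provide the strictly feasible point and the witness for \<open>Top\<close>. The witnesses of the
  other inequalities sit at the height of their own patch.\<close>

lemma stack_polytope_facets:
  assumes d: "0 < d"
  shows "affine_dim (stack_polytope d) = int (Suc d)"
    "card {F. is_facet F (stack_polytope d)} = (2 * d + 1) * (d + 1) + 1"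
proof -
  have flat: "\<exists>x\<in>coord_space (Suc d). mean d x = t \<and> (\<forall>i\<le>d. slack_patch d x i)" if t: "0 < t" for t
  proof -
    obtain x where x: "x \<in> coord_space (Suc d)" "mean d x = t" "\<And>r. r < d \<Longrightarrow> tilt d 0 x r = 0"
      using exists_point[OF d, of 0 t "\<lambda>_. 0"] by auto
    have d0: "dev d x 0 = 0" using dev_eq_sum_tilt[of 0 d x] d x(3) by simp
    have dev: "dev d x j = 0" if "j \<le> d" for j
      using rot_cases[of 0 d j] d0 x(3) that unfolding tilt_def by force
    have "slack_patch d x i" if "i \<le> d" for i
      by (rule slack_patchI[OF d that, of _ "1/4"])
        (use x(2) t dev rad_ge_1[of t i] in auto)
    with x show ?thesis by blast
  qed
  have top: "(1::real) < 2 * (32 ^ d)\<^sup>2"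
    using one_le_power[of "(32::real) ^ d" 2] one_le_power[of "32::real" d] by linarith
  obtain p where p: "p \<in> coord_space (Suc d)" "mean d p = 1" "\<forall>i\<le>d. slack_patch d p i"
    using flat[of 1] by auto
  have p': "ineq_fun d a p < 0" if "a \<in> ineqs d" for a
  proof -
    have "\<forall>a\<in>ineqs d. ineq_fun d a p < 0"
      unfolding ineqs_iff using p top by (auto simp: slack_patch_def)
    then show ?thesis using that by blast
  qed
  have wit: "\<exists>z\<in>coord_space (Suc d). ineq_fun d a z = 0 \<and>
      (\<forall>b\<in>ineqs d. b \<noteq> a \<longrightarrow> ineq_fun d b z < 0)" if a: "a \<in> ineqs d" for a
  proof (cases a)
    case (Up i r)
    then have ir: "i \<le> d" "r < d" using a unfolding ineqs_def by auto
    \<comment> \<open>Equality occurs only at \<open>r\<close>, as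
      \<open>1/2 = 2 * (1/4)\<close>.\<close>
    define u :: "nat \<Rightarrow> real" where "u k = (if k = r then 1/2 else 1/4)" for k
    have u: "0 < u k" "u k < 1" for k unfolding u_def by auto
    obtain x where x: "x \<in> coord_space (Suc d)"
        "\<And>k. k \<le> d \<Longrightarrow> level d i x k = u k"
        "ineq_fun d Top x < 0" "ineq_fun d (Cap i) x < 0"
        "\<And>j. j \<le> d \<Longrightarrow> j \<noteq> i \<Longrightarrow> slack_patch d x j"
      using exists_level_point[OF d ir(1), of u] u by (metis less_imp_le)
    have up: "ineq_fun d (Up i k) x < 0" if "k < d" "k \<noteq> r" for k
      using that x(2)[of k] x(2)[of "Suc k"] by (simp add: u_def)
    have down: "ineq_fun d (Down i k) x < 0" if "k < d" for k
      using that x(2)[of k] x(2)[of "Suc k"] by (simp add: u_def)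
    have "\<forall>b\<in>ineqs d. b \<noteq> a \<longrightarrow> ineq_fun d b x < 0"
      unfolding ineqs_iff Up using x up down unfolding slack_patch_def by (metis ineq.inject(1))
    moreover have "ineq_fun d a x = 0" unfolding Up using ir x(2)[of r] x(2)[of "Suc r"] by (simp add: u_def)
    ultimately show ?thesis using x(1) by blast
  next
    case (Down i r)
    then have ir: "i \<le> d" "r < d" using a unfolding ineqs_def by auto
    \<comment> \<open>Equality occurs only at \<open>r\<close>, as
      \<open>1/4 + 2 * (7/8) = 2\<close>. The value \<open>1/2\<close> after \<open>7/8\<close> is
      the peak of the tent and leaves room for it.\<close>
    define u :: "nat \<Rightarrow> real" where "u k = (if k \<le> r then 1/4 else if k = Suc r then 7/8 else 1/2)" for k
    have u: "0 < u k" "u k < 1" for k unfolding u_def by auto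
    obtain x where x: "x \<in> coord_space (Suc d)"
        "\<And>k. k \<le> d \<Longrightarrow> level d i x k = u k"
        "ineq_fun d Top x < 0" "ineq_fun d (Cap i) x < 0"
        "\<And>j. j \<le> d \<Longrightarrow> j \<noteq> i \<Longrightarrow> slack_patch d x j"
      using exists_level_point[OF d ir(1), of u] u by (metis less_imp_le)
    have up: "ineq_fun d (Up i k) x < 0" if "k < d" for k
      using that x(2)[of k] x(2)[of "Suc k"] by (auto simp: u_def)
    have down: "ineq_fun d (Down i k) x < 0" if "k < d" "k \<noteq> r" for k
      using that x(2)[of k] x(2)[of "Suc k"] by (auto simp: u_def)
    have "\<forall>b\<in>ineqs d. b \<noteq> a \<longrightarrow> ineq_fun d b x < 0"
      unfolding ineqs_iff Down using x up down unfolding slack_patch_def by (metis ineq.inject(2))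
    moreover have "ineq_fun d a x = 0"
      unfolding Down using ir x(2)[of r] x(2)[of "Suc r"] by (simp add: u_def)
    ultimately show ?thesis using x(1) by blast
  next
    case (Cap i)
    then have i: "i \<le> d" using a unfolding ineqs_def by auto
    \<comment> \<open>This height gives level \<open>d\<close> the value \<open>1/4\<close>. Equal
      tilts \<open>- R / (2 * d)\<close> give \<open>dev d x i = R\<close>, so \<open>Cap i\<close>
      is tight while the levels below \<open>d\<close> are negative.\<close>
    define t :: real where "t = 5/4 * (32 ^ i)\<^sup>2"
    define R where "R = rad i t"
    obtain x where x: "x \<in> coord_space (Suc d)" "mean d x = t"
        "\<And>r. r < d \<Longrightarrow> tilt d i x r = - R / (2 * d)"
      using exists_point[OF d i, of t "\<lambda>_. - R / (2 * d)"] by auto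
    have t: "0 < t" "(32 ^ i)\<^sup>2 \<le> t" unfolding t_def by simp_all
    have R: "1 \<le> R" unfolding R_def using rad_ge_1 t by simp
    have "t / 32 ^ i = 5/4 * 32 ^ i" unfolding t_def by (simp add: power2_eq_square)
    moreover have "(0::real) \<le> 32 ^ i" by simp
    ultimately have R3: "R \<le> 8 * 32 ^ i" unfolding R_def rad_def by linarith
    have di: "dev d x i = R" using dev_eq_sum_tilt[OF i d, of x] x(3) d by simp
    have dr: "dev d x (rot d i r) \<le> 8 * 32 ^ i" if "r < d" for r
    proof -
      have "dev d x (rot d i r) = - (R / (2 * d)) - R / (2 * d)"
        using x(3)[OF that] di unfolding tilt_def by simp
      moreover have "0 \<le> R / (2 * d)" "(0::real) \<le> 32 ^ i" using R by simp_all
      ultimately show ?thesis by linarith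
    qed
    have Z: "dev d x k \<le> 8 * 32 ^ i" if "k \<le> d" for k
      using rot_cases[OF i that] di R3 dr by metis
    have other: "slack_patch d x j" if "j \<le> d" "j \<noteq> i" for j
      using slack_other_patches[OF d i that] t Z x(2) by blast
    have ld: "level d i x d = 1/4" unfolding level_def x(2) t_def by simp
    define B where "B = 8 * (real d + 1)"
    define e where "e = R + R / (2 * d)"
    have e: "0 < e" unfolding e_def using R d by (simp add: add_pos_nonneg)
    have B: "2 < B" unfolding B_def by simp
    have lr: "level d i x r = - e * B ^ (d - r)" if "r < d" for r
      using that x(2,3) unfolding level_def B_def e_def R_def by simp
    have neg: "level d i x r < 0" if "r < d" for r
      unfolding lr[OF that] using e B by simp
    have updown: "ineq_fun d (Up i r) x < 0 \<and> ineq_fun d (Down i r) x < 0" if r: "r < d" for r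
    proof (cases "Suc r < d")
      case True
      have "2 * (e * B ^ (d - Suc r)) < B * (e * B ^ (d - Suc r))"
        using B e by (intro mult_strict_right_mono) auto
      moreover have "B * B ^ (d - Suc r) = B ^ (d - r)"
        using r by (metis Suc_diff_Suc power_Suc)
      ultimately have "2 * (e * B ^ (d - Suc r)) < e * B ^ (d - r)" by (metis mult.left_commute)
      then show ?thesis using neg[OF r] neg[OF True] lr[OF r] lr[OF True] by simp
    next
      case False
      then have "Suc r = d" using r by simp
      then show ?thesis using neg[OF r] ld by simp
    qed
    have "(32 ^ i :: real) \<le> 32 ^ d" using i by (intro power_increasing) auto
    then have "(32 ^ i :: real)\<^sup>2 \<le> (32 ^ d)\<^sup>2" by (intro power_mono) auto
    moreover have "(0::real) < (32 ^ d)\<^sup>2" by simp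
    ultimately have "t < 2 * (32 ^ d)\<^sup>2" unfolding t_def by linarith
    then have Top: "ineq_fun d Top x < 0" using x(2) by simp
    have "\<forall>b\<in>ineqs d. b \<noteq> a \<longrightarrow> ineq_fun d b x < 0"
      unfolding ineqs_iff Cap using Top updown other unfolding slack_patch_def by metis
    moreover have "ineq_fun d a x = 0" unfolding Cap using di x(2) by (simp add: R_def)
    ultimately show ?thesis using x(1) by blast
  next
    case Top
    obtain x where x: "x \<in> coord_space (Suc d)" "mean d x = 2 * (32 ^ d)\<^sup>2" "\<forall>i\<le>d. slack_patch d x i"
      using flat[of "2 * (32 ^ d)\<^sup>2"] by auto
    have "\<forall>b\<in>ineqs d. b \<noteq> a \<longrightarrow> ineq_fun d b x < 0"
      unfolding ineqs_iff Top using x unfolding slack_patch_def by blast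
    then show ?thesis unfolding Top using x by auto
  qed
  show "affine_dim (stack_polytope d) = int (Suc d)"
    using ineq.card_facets(1)[OF affine_axis_basis(1,2,3) p(1) p' wit] affine_axis_basis(4)
    unfolding stack_polytope_def by simp
  show "card {F. is_facet F (stack_polytope d)} = (2 * d + 1) * (d + 1) + 1"
    using ineq.card_facets(2)[OF affine_axis_basis(1,2,3) p(1) p' wit] card_ineqs
    unfolding stack_polytope_def by simp
qed

section \<open>Coherent paths are long\<close>

definition all_ones :: "nat \<Rightarrow> (nat \<Rightarrow>\<^sub>0 real)" where
  "all_ones d = (\<Sum>j\<le>d. Poly_Mapping.single j 1)"

lemma lookup_all_ones: "Poly_Mapping.lookup (all_ones d) j = (if j \<le> d then 1 else 0)"
proof -
  have "Poly_Mapping.lookup (all_ones d) j = (\<Sum>k\<le>d. if k = j then 1 else 0)"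
    unfolding all_ones_def by (auto simp: lookup_sum lookup_single when_def intro!: sum.cong)
  then show ?thesis by simp
qed

lemma all_ones_in_coord_space: "all_ones d \<in> coord_space (Suc d)"
  by (simp add: in_coord_space_iff lookup_all_ones)

lemma dot_eq_sum:
  assumes "w \<in> coord_space (Suc d)"
  shows "dot w x = (\<Sum>j\<le>d. Poly_Mapping.lookup w j * Poly_Mapping.lookup x j)"
  unfolding dot_def
  by (rule sum.mono_neutral_left)
    (use assms in \<open>auto simp: in_coord_space_iff in_keys_iff not_le[symmetric]\<close>)

lemma dot_add_all_ones:
  assumes "w \<in> coord_space (Suc d)"
  shows "dot (w + t *\<^sub>R all_ones d) x = dot w x + t * (real d + 1) * mean d x"
proof -
  have "w + t *\<^sub>R all_ones d \<in> coord_space (Suc d)"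
    using assms all_ones_in_coord_space subspace_coord_space by (simp add: subspace_add subspace_scale)
  then have "dot (w + t *\<^sub>R all_ones d) x =
      (\<Sum>j\<le>d. Poly_Mapping.lookup w j * Poly_Mapping.lookup x j + t * Poly_Mapping.lookup x j)"
    by (subst dot_eq_sum) (auto simp: lookup_add lookup_all_ones distrib_right intro!: sum.cong)
  then show ?thesis
    by (simp add: dot_eq_sum[OF assms] sum.distrib sum_distrib_left[symmetric] sum_lookup_eq_mean)
qed

lemma affine_fun_dot: "affine_fun (dot w)"
  unfolding dot_def by (intro affine_fun_sum affine_fun_cmult affine_fun_lookup)

text \<open>Since the tilts sum to \<open>- dev d x i / 2\<close>, adding \<open>S / d\<close> to
  each weight cancels exactly the contribution of the correction term in
  \<open>tilt\<close>.\<close>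

lemma dot_eq_tilt:
  assumes d: "0 < d" "i \<le> d" and w: "w \<in> coord_space (Suc d)"
    and \<alpha>: "\<And>j. \<alpha> j = Poly_Mapping.lookup w j - Poly_Mapping.lookup w i"
    and S: "S = (\<Sum>j\<le>d. \<alpha> j)"
  shows "dot w x = ((real d + 1) * Poly_Mapping.lookup w i + S) * mean d x +
    (\<Sum>r<d. (\<alpha> (rot d i r) + S / d) * tilt d i x r)"
proof -
  have \<alpha>i: "\<alpha> i = 0" by (simp add: \<alpha>)
  have S': "(\<Sum>r<d. \<alpha> (rot d i r)) = S" unfolding S using sum_rot[OF d(2), of \<alpha>] \<alpha>i by simp
  have "dot w x = (\<Sum>j\<le>d. Poly_Mapping.lookup w i * Poly_Mapping.lookup x j +
      (\<alpha> j * mean d x + \<alpha> j * dev d x j))"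
    unfolding dot_eq_sum[OF w] by (intro sum.cong) (auto simp: \<alpha> dev_def algebra_simps)
  also have "\<dots> = Poly_Mapping.lookup w i * ((real d + 1) * mean d x) + (S * mean d x +
      (\<Sum>j\<le>d. \<alpha> j * dev d x j))"
    by (simp add: sum.distrib sum_distrib_left[symmetric] sum_distrib_right[symmetric]
        sum_lookup_eq_mean S)
  also have "(\<Sum>j\<le>d. \<alpha> j * dev d x j) = (\<Sum>r<d. \<alpha> (rot d i r) * dev d x (rot d i r))"
    using sum_rot[OF d(2), of "\<lambda>j. \<alpha> j * dev d x j"] \<alpha>i by simp
  also have "\<dots> = (\<Sum>r<d. (\<alpha> (rot d i r) + S / d) * tilt d i x r)"
  proof -
    have expand: "(a + c) * (b + e) = a * b + (a * e + c * (b + e))" for a b c e :: real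
      by (simp add: algebra_simps)
    have "(\<Sum>r<d. (\<alpha> (rot d i r) + S / d) * tilt d i x r) =
        (\<Sum>r<d. \<alpha> (rot d i r) * dev d x (rot d i r) +
          (\<alpha> (rot d i r) * (dev d x i / (2 * real d)) + S / d * tilt d i x r))"
      by (intro sum.cong refl) (simp only: tilt_def expand)
    also have "\<dots> = (\<Sum>r<d. \<alpha> (rot d i r) * dev d x (rot d i r)) +
          (S * (dev d x i / (2 * real d)) + S / d * (\<Sum>r<d. tilt d i x r))"
      by (simp only: sum.distrib sum_distrib_left[symmetric] sum_distrib_right[symmetric] S')
    also have "(\<Sum>r<d. tilt d i x r) = - dev d x i / 2"
      using dev_eq_sum_tilt[OF d(2,1), of x] by simp
    finally show ?thesis by (simp add: field_simps)
  qed
  finally show ?thesis by (simp add: algebra_simps)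
qed

text \<open>The weights of the levels satisfy the growth condition of
  \<open>tent_chain_bound\<close>. With a suitable \<open>t\<close> the objective becomes, up to a
  constant, the difference of the two sides of that bound, whose equality case is the orbit of
  \<open>E\<close>.\<close>

lemma unique_maximizer:
  assumes d: "0 < d" "i \<le> d" and w: "w \<in> coord_space (Suc d)"
    and min: "\<And>j. j \<le> d \<Longrightarrow> Poly_Mapping.lookup w i \<le> Poly_Mapping.lookup w j"
    and nonconst: "\<exists>j\<le>d. Poly_Mapping.lookup w j \<noteq> Poly_Mapping.lookup w i"
  shows "\<exists>t x. maximizers (stack_polytope d) (w + t *\<^sub>R all_ones d) = {x} \<and>
    (\<forall>r\<le>d. level d i x r = tent_orbit E r)"
proof -
  define \<alpha> where "\<alpha> j = Poly_Mapping.lookup w j - Poly_Mapping.lookup w i" for j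
  define S where "S = (\<Sum>j\<le>d. \<alpha> j)"
  define B where "B = 8 * (real d + 1)"
  define l where "l r = (\<alpha> (rot d i r) + S / d) / B ^ (d - r)" for r
  have \<alpha>0: "0 \<le> \<alpha> j" if "j \<le> d" for j using min[OF that] by (simp add: \<alpha>_def)
  obtain j where "j \<le> d" "0 < \<alpha> j" using nonconst min by (force simp: \<alpha>_def)
  then have S: "0 < S" unfolding S_def using \<alpha>0 by (intro sum_pos2[of _ j]) auto
  have \<alpha>S: "\<alpha> j \<le> S" if "j \<le> d" for j
    unfolding S_def using \<alpha>0 that by (intro member_le_sum) auto
  have Sd: "0 < S / d" "S / d \<le> S" using S d(1) by (simp_all add: divide_le_eq)
  have B: "0 < B" "B * (S / d) > 8 * S" unfolding B_def using S d(1) by (simp_all add: field_simps)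
  have l0: "0 < l r" if "r < d" for r
    unfolding l_def using \<alpha>0[OF rot_le[OF d(2) that]] Sd B by (intro divide_pos_pos) auto
  have l4: "4 * l r < l (Suc r)" if "Suc r < d" for r
  proof -
    have "4 * (\<alpha> (rot d i r) + S / d) \<le> 8 * S"
      using \<alpha>S[OF rot_le[OF d(2), of r]] that Sd by simp
    also have "\<dots> < B * (S / d)" by (rule B)
    also have "\<dots> \<le> B * (\<alpha> (rot d i (Suc r)) + S / d)"
      using \<alpha>0[OF rot_le[OF d(2) that]] B by (intro mult_left_mono) auto
    finally have "4 * (\<alpha> (rot d i r) + S / d) / B ^ (d - r) <
        B * (\<alpha> (rot d i (Suc r)) + S / d) / B ^ (d - r)"
      using B by (intro divide_strict_right_mono) auto
    moreover have "B ^ (d - r) = B * B ^ (d - Suc r)"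
      using that by (metis Suc_diff_Suc Suc_lessD power_Suc)
    ultimately show ?thesis unfolding l_def using B by simp
  qed
  obtain m where m: "d = Suc m" using d(1) by (metis Suc_pred')
  have "\<exists>K \<tau>. \<bar>\<tau>\<bar> \<le> 4 * l m \<and> (\<forall>u. tent_chain (Suc m) u \<longrightarrow>
     (\<Sum>r\<le>m. l r * u r) \<le> K + \<tau> * u (Suc m) \<and>
     ((\<Sum>r\<le>m. l r * u r) = K + \<tau> * u (Suc m) \<longleftrightarrow> (\<forall>r\<le>Suc m. u r = tent_orbit E r)))"
    by (rule tent_chain_bound) (use l0 l4 m in auto)
  then obtain K \<tau> where
      bound: "\<And>u. tent_chain d u \<Longrightarrow> (\<Sum>r<d. l r * u r) \<le> K + \<tau> * u d"
    and eq: "\<And>u. tent_chain d u \<Longrightarrow>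
        (\<Sum>r<d. l r * u r) = K + \<tau> * u d \<longleftrightarrow> (\<forall>r\<le>d. u r = tent_orbit E r)"
    unfolding m lessThan_Suc_atMost by blast
  define \<Lambda> where "\<Lambda> = (\<Sum>r<d. \<alpha> (rot d i r) + S / d)"
  define k where "k = (real d + 1) * Poly_Mapping.lookup w i + S + \<Lambda> / 32 ^ i"
  have dot_w: "dot w x = k * mean d x + \<Lambda> * 32 ^ i + (\<Sum>r<d. l r * level d i x r)" for x
  proof -
    have "(\<Sum>r<d. (\<alpha> (rot d i r) + S / d) * tilt d i x r) =
        (\<Sum>r<d. (\<alpha> (rot d i r) + S / d) * rad i (mean d x) + l r * level d i x r)"
      by (intro sum.cong) (auto simp: tilt_eq_level l_def B_def distrib_left)
    also have "\<dots> = \<Lambda> * rad i (mean d x) + (\<Sum>r<d. l r * level d i x r)"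
      unfolding \<Lambda>_def sum_distrib_right by (rule sum.distrib)
    finally show ?thesis
      using dot_eq_tilt[OF d w \<alpha>_def S_def, of x] by (simp add: k_def rad_def algebra_simps)
  qed
  \<comment> \<open>Cancels \<open>k\<close> and leaves the coefficient \<open>- \<tau>\<close> for
    level \<open>d\<close>, because the mean is \<open>(32 ^ i)\<^sup>2\<close> times that level
    plus one.\<close>
  define t where "t = - (k + \<tau> / (32 ^ i)\<^sup>2) / (real d + 1)"
  have tk: "t * (real d + 1) = - k - \<tau> / (32 ^ i)\<^sup>2" unfolding t_def by (simp add: add_nonneg_eq_0_iff)
  define c where "c = \<Lambda> * 32 ^ i + K - \<tau>"
  have obj: "dot (w + t *\<^sub>R all_ones d) x =
      c + ((\<Sum>r<d. l r * level d i x r) - (K + \<tau> * level d i x d))" for x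
  proof -
    have "\<tau> / (32 ^ i)\<^sup>2 * mean d x = \<tau> * (level d i x d + 1)" unfolding level_def by simp
    then have "t * (real d + 1) * mean d x = - k * mean d x - \<tau> * (level d i x d + 1)"
      unfolding tk left_diff_distrib by simp
    then show ?thesis unfolding dot_add_all_ones[OF w] dot_w c_def by (simp add: algebra_simps)
  qed
  have "0 < tent_orbit E r" "tent_orbit E r \<le> 1" "tent_orbit E d < 1" for r
    using tent_orbit_bounds tent_orbit_Suc_less_1[of E m] m by auto
  then obtain x where x: "x \<in> coord_space (Suc d)" "\<And>r. r \<le> d \<Longrightarrow> level d i x r = tent_orbit E r"
    "ineq_fun d Top x < 0" "ineq_fun d (Cap i) x < 0"
    "\<And>j. j \<le> d \<Longrightarrow> j \<noteq> i \<Longrightarrow> slack_patch d x j"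
    using exists_level_point[OF d] by metis
  have xP: "x \<in> stack_polytope d"
    unfolding mem_stack_polytope ineqs_iff
  proof (intro conjI allI impI)
    fix j assume j: "j \<le> d"
    show "ineq_fun d (Cap j) x \<le> 0"
      using x(4) x(5)[OF j] unfolding slack_patch_def by (cases "j = i") auto
    fix r assume r: "r < d"
    have "ineq_fun d (Up j r) x \<le> 0 \<and> ineq_fun d (Down j r) x \<le> 0"
    proof (cases "j = i")
      case True
      then show ?thesis
        using x(2)[of r] x(2)[of "Suc r"] r tent_chain_orbit[of d E] unfolding tent_chain_def by force
    next
      case False
      then show ?thesis using x(5)[OF j] r unfolding slack_patch_def by (meson less_imp_le)
    qed
    then show "ineq_fun d (Up j r) x \<le> 0" "ineq_fun d (Down j r) x \<le> 0" by blast+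
  qed (use x in auto)
  have le: "dot (w + t *\<^sub>R all_ones d) y \<le> c" if "y \<in> stack_polytope d" for y
    unfolding obj using bound[OF tent_chain_level[OF that d(2)]] by simp
  have iff: "dot (w + t *\<^sub>R all_ones d) y = c \<longleftrightarrow> y = x" if y: "y \<in> stack_polytope d" for y
  proof -
    have "dot (w + t *\<^sub>R all_ones d) y = c \<longleftrightarrow> (\<forall>r\<le>d. level d i y r = tent_orbit E r)"
      unfolding obj using eq[OF tent_chain_level[OF y d(2)]] by auto
    also have "\<dots> \<longleftrightarrow> y = x"
    proof
      assume "\<forall>r\<le>d. level d i y r = tent_orbit E r"
      then show "y = x"
        using eq_of_levels[OF d, of y x] y x(1,2) unfolding mem_stack_polytope by metis
    qed (use x(2) in auto)
    finally show ?thesis .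
  qed
  have "maximizers (stack_polytope d) (w + t *\<^sub>R all_ones d) = {x}"
  proof (intro set_eqI iffI)
    fix y assume "y \<in> maximizers (stack_polytope d) (w + t *\<^sub>R all_ones d)"
    then have y: "y \<in> stack_polytope d"
      "dot (w + t *\<^sub>R all_ones d) x \<le> dot (w + t *\<^sub>R all_ones d) y"
      using xP unfolding maximizers_def by auto
    then have "dot (w + t *\<^sub>R all_ones d) y = c" using le[OF y(1)] iff[OF xP] by simp
    then show "y \<in> {x}" using iff[OF y(1)] by simp
  next
    fix y assume "y \<in> {x}"
    then show "y \<in> maximizers (stack_polytope d) (w + t *\<^sub>R all_ones d)"
      unfolding maximizers_def using xP le iff[OF xP] by auto
  qed
  then show ?thesis using x(2) by blast
qed

lemma singleton_in_path_faces: "{x} \<in> path_faces vs \<Longrightarrow> x \<in> set vs"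
  unfolding path_faces_def by (auto simp: closed_segment_eq_sing) (metis Suc_lessD ends_in_segment(1) nth_mem singletonD)

text \<open>All vertices counted here belong to the patch of a smallest entry of \<open>w\<close>;
  the subsets of \<open>{1..<d}\<close> have distinct orbits and hence give distinct vertices of the
  path.\<close>

lemma coherent_path_long:
  assumes d: "0 < d" and coh: "coherent_path (Suc d) (stack_polytope d) (all_ones d) vs"
  shows "2 ^ (d - 1) \<le> length vs"
proof -
  obtain w where w: "w \<in> coord_space (Suc d)" "all_ones d \<noteq> w" "independent {all_ones d, w}"
      and faces: "{maximizers (stack_polytope d) (w + t *\<^sub>R all_ones d) | t. t \<in> UNIV} = path_faces vs"
    using coh unfolding coherent_path_def by blast
  have "Min (Poly_Mapping.lookup w ` {..d}) \<in> Poly_Mapping.lookup w ` {..d}" by (intro Min_in) auto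
  then obtain i where i: "i \<le> d" "Poly_Mapping.lookup w i = Min (Poly_Mapping.lookup w ` {..d})" by force
  then have min: "Poly_Mapping.lookup w i \<le> Poly_Mapping.lookup w j" if "j \<le> d" for j
    using that by simp
  have nonconst: "\<exists>j\<le>d. Poly_Mapping.lookup w j \<noteq> Poly_Mapping.lookup w i"
  proof (rule ccontr)
    assume "\<not> ?thesis"
    then have "w = Poly_Mapping.lookup w i *\<^sub>R all_ones d"
      using w(1) by (intro poly_mapping_eqI) (auto simp: lookup_all_ones in_coord_space_iff)
    then have "w \<in> span {all_ones d}" by (metis span_base span_scale singletonI)
    moreover have "independent (insert w {all_ones d})" using w(3) by (simp add: insert_commute)
    ultimately show False using w(2) by (simp add: independent_insert split: if_splits)
  qed
  have "\<exists>x\<in>set vs. \<forall>r\<le>d. level d i x r = tent_orbit E r" for E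
  proof -
    obtain t x where x: "maximizers (stack_polytope d) (w + t *\<^sub>R all_ones d) = {x}"
        "\<forall>r\<le>d. level d i x r = tent_orbit E r"
      using unique_maximizer[OF d i(1) w(1) min nonconst] by blast
    have "maximizers (stack_polytope d) (w + t *\<^sub>R all_ones d) \<in> path_faces vs"
      unfolding faces[symmetric] by blast
    then have "x \<in> set vs" unfolding x(1) by (rule singleton_in_path_faces)
    then show ?thesis using x(2) by blast
  qed
  then obtain x where x: "\<And>E. x E \<in> set vs" "\<And>E r. r \<le> d \<Longrightarrow> level d i (x E) r = tent_orbit E r"
    by metis
  have "inj_on x (Pow {1..<d})"
    by (rule inj_onI) (metis PowD tent_orbit_inj x(2))
  then have "card (Pow {1..<d}) \<le> card (set vs)"
    using x(1) by (intro card_inj_on_le[of x]) auto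
  then show ?thesis using card_length[of vs] by (simp add: card_Pow)
qed

text \<open>A flip removes at least one vertex and inserts at most
  \<open>card (ineqs d) + 1\<close>, so the extra one cancels.\<close>

lemma flip_length:
  assumes "flip_adjacent (stack_polytope d) (all_ones d) us vs"
  shows "length vs \<le> length us + card (ineqs d)"
proof -
  obtain F pre as bs post where F: "F face_of stack_polytope d" "affine_dim F = 2"
      and path: "monotone_path F (all_ones d) as" "monotone_path F (all_ones d) bs"
      and eq: "us = pre @ as @ post" "vs = pre @ bs @ post"
    using assms unfolding flip_adjacent_def by blast
  have "length bs \<le> card (ineqs d) + 1"
  proof (rule ineq.two_face_path_length[where f = "dot (all_ones d)", OF affine_axis_basis(1)])
    show "coord_space (Suc d) \<subseteq> affine hull insert 0 (axis_basis d)" using affine_axis_basis(3) by simp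
    show "F face_of ineq.feasible d" using F(1) unfolding stack_polytope_def .
  qed (use F path affine_fun_dot in \<open>auto simp: monotone_path_def\<close>)
  moreover have "1 \<le> length as" using path(1) unfolding monotone_path_def by (simp add: Suc_leI)
  ultimately show ?thesis unfolding eq by simp
qed

lemma flips_length:
  "(flip_adjacent (stack_polytope d) (all_ones d) ^^ k) us vs \<Longrightarrow>
    length vs \<le> length us + k * card (ineqs d)"
proof (induction k arbitrary: vs)
  case (Suc k)
  then obtain xs where "(flip_adjacent (stack_polytope d) (all_ones d) ^^ k) us xs"
      "flip_adjacent (stack_polytope d) (all_ones d) xs vs" by auto
  then show ?case using Suc.IH[of xs] flip_length[of d xs vs] by simp
qed simp

text \<open>A nonempty set of extended naturals attains its infimum, and the empty set has infimum
  infinity. The bound \<open>r\<close> may be negative, hence the comparison in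
  \<open>ereal\<close>.\<close>

lemma less_flip_distance:
  assumes "\<And>k. (flip_adjacent P c ^^ k) us vs \<Longrightarrow> r < real k"
  shows "ereal r < ereal_of_enat (flip_distance P c us vs)"
proof (cases "\<exists>k. (flip_adjacent P c ^^ k) us vs")
  case True
  then obtain k where "(flip_adjacent P c ^^ k) us vs" by blast
  then have "flip_distance P c us vs \<in> enat ` {k. (flip_adjacent P c ^^ k) us vs}"
    unfolding flip_distance_def by (intro wellorder_InfI[of "enat k"]) auto
  then show ?thesis using assms by auto
next
  case False
  then show ?thesis unfolding flip_distance_def by (simp add: top_enat_def)
qed

section \<open>Asymptotic comparison and conclusion\<close>

lemma poly_less_exponential:
  fixes p :: "real poly"
  shows "eventually (\<lambda>n. poly p (real n) < 2 ^ (n - 1)) sequentially"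
proof -
  have "(\<lambda>n. coeff p i * (real n ^ i / 2 ^ n)) \<longlonglongrightarrow> 0" for i
  proof -
    have "(\<lambda>n. real n ^ i / 2 ^ n) \<longlonglongrightarrow> 0" by real_asymp
    then show ?thesis by (rule tendsto_mult_right_zero)
  qed
  then have "(\<lambda>n. \<Sum>i\<le>degree p. coeff p i * (real n ^ i / 2 ^ n)) \<longlonglongrightarrow> 0"
    by (intro tendsto_null_sum)
  moreover have "(\<Sum>i\<le>degree p. coeff p i * (real n ^ i / 2 ^ n)) = poly p (real n) / 2 ^ n" for n
    by (simp add: poly_altdef sum_divide_distrib)
  ultimately have "(\<lambda>n. poly p (real n) / 2 ^ n) \<longlonglongrightarrow> 0" by simp
  then have "eventually (\<lambda>n. poly p (real n) / 2 ^ n < 1 / 2) sequentially"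
    by (rule order_tendstoD) simp
  moreover have "eventually (\<lambda>n. 0 < n) sequentially" by (rule eventually_gt_at_top)
  ultimately show ?thesis
  proof eventually_elim
    case (elim n)
    then obtain m where "n = Suc m" by (metis Suc_pred')
    then show ?case using elim by (simp add: divide_less_eq)
  qed
qed

theorem corollary1p2:
  shows "\<exists>(P :: nat \<Rightarrow> (nat \<Rightarrow>\<^sub>0 real) set) (c :: nat \<Rightarrow> (nat \<Rightarrow>\<^sub>0 real)).
    (\<forall>d\<ge>3. polytope (P d) \<and> P d \<subseteq> coord_space (d + 1) \<and>
       affine_dim (P d) = int (d + 1) \<and>
       card {F. is_facet F (P d)} = (2 * d + 1) * (d + 1) + 1 \<and>
       c d \<in> coord_space (d + 1) \<and> c d \<noteq> 0) \<and>
    (\<forall>p q :: real poly. \<exists>d0\<ge>3. \<forall>d\<ge>d0. \<forall>us vs.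
       monotone_path (P d) (c d) us \<longrightarrow>
       real (path_length us) \<le> poly p (real d) \<longrightarrow>
       coherent_path (d + 1) (P d) (c d) vs \<longrightarrow>
       ereal (poly q (real d)) < ereal_of_enat (flip_distance (P d) (c d) us vs))"
proof (rule exI[of _ stack_polytope], rule exI[of _ all_ones], intro conjI allI impI)
  fix d :: nat assume "3 \<le> d"
  then have d: "0 < d" by simp
  show "polytope (stack_polytope d)" using polytope_stack_polytope[OF d] .
  show "stack_polytope d \<subseteq> coord_space (d + 1)" using mem_stack_polytope by auto
  show "affine_dim (stack_polytope d) = int (d + 1)" using stack_polytope_facets(1)[OF d] by simp
  show "card {F. is_facet F (stack_polytope d)} = (2 * d + 1) * (d + 1) + 1"
    using stack_polytope_facets(2)[OF d] .
  show "all_ones d \<in> coord_space (d + 1)" using all_ones_in_coord_space by simp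
  show "all_ones d \<noteq> 0" using lookup_all_ones[of d 0] by auto
next
  fix p q :: "real poly"
  define N :: "real poly" where "N = [:2, 3, 2:]"
  have N: "real (card (ineqs d)) = poly N (real d)" for d
    unfolding card_ineqs N_def by (simp add: algebra_simps)
  \<comment> \<open>A path of length at most \<open>p\<close> has at most \<open>p + 1\<close>
    vertices, and \<open>q\<close> flips add at most \<open>q * N\<close>; a total below
    \<open>2 ^ (d - 1)\<close> reaches no coherent path.\<close>
  obtain d1 where d1: "\<And>d. d \<ge> d1 \<Longrightarrow> poly (p + 1 + q * N) (real d) < 2 ^ (d - 1)"
    using poly_less_exponential unfolding eventually_sequentially by blast
  show "\<exists>d0\<ge>3. \<forall>d\<ge>d0. \<forall>us vs.
       monotone_path (stack_polytope d) (all_ones d) us \<longrightarrow>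
       real (path_length us) \<le> poly p (real d) \<longrightarrow>
       coherent_path (d + 1) (stack_polytope d) (all_ones d) vs \<longrightarrow>
       ereal (poly q (real d)) < ereal_of_enat (flip_distance (stack_polytope d) (all_ones d) us vs)"
  proof (intro exI[of _ "max 3 d1"] conjI allI impI less_flip_distance)
    fix d us vs k
    assume d: "max 3 d1 \<le> d" and us: "monotone_path (stack_polytope d) (all_ones d) us"
      and len: "real (path_length us) \<le> poly p (real d)"
      and vs: "coherent_path (d + 1) (stack_polytope d) (all_ones d) vs"
      and k: "(flip_adjacent (stack_polytope d) (all_ones d) ^^ k) us vs"
    show "poly q (real d) < real k"
    proof (rule ccontr)
      assume "\<not> poly q (real d) < real k"
      then have "real k * real (card (ineqs d)) \<le> poly q (real d) * poly N (real d)"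
        unfolding N[symmetric] by (intro mult_right_mono) auto
      moreover have "2 ^ (d - 1) \<le> length us + k * card (ineqs d)"
        using coherent_path_long[of d vs] vs flips_length[OF k] d by simp
      then have "real (2 ^ (d - 1)) \<le> real (length us + k * card (ineqs d))"
        by (subst of_nat_le_iff)
      moreover have "real (length us) \<le> poly p (real d) + 1"
        using len us unfolding path_length_def monotone_path_def by (cases us) auto
      ultimately have "2 ^ (d - 1) \<le> poly (p + 1 + q * N) (real d)" by simp
      then show False using d1[of d] d by simp
    qed
  qed simp
qed

end
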